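(* Let $S=NA$ be a Damek–Ricci space with homogeneous dimension $Q=\frac12\dim\mathfrak h+\dim\mathfrak z$. Let $a\in\mathbb R$, let $k\ge 1$ be an integer and let $f\in C^\infty(S)$. Then $$\varrho^{\frac{k+Q+a}{2}}\prod_{j=1}^{k}\Big[\varrho\,\partial_{\varrho\varrho}+a\,\partial_\varrho+\varrho\,\Delta_Z+\mathcal L_0-(k+1-2j)\sqrt{-\Delta_Z}\Big]\Big(\varrho^{\frac{k-Q-a}{2}}f\Big)$$ $$=\prod_{j=1}^{k}\Big\{\varrho\big[\varrho(\partial_{\varrho\varrho}+\Delta_Z)+\mathcal L_0-(Q-1)\partial_\varrho\big]+\frac{Q^2}{4}-\frac{(a-k+2j-2)^2}{4}\Big\}f .$$
   Context: $N$ is a group of Heisenberg type with Lie algebra $\mathfrak n=\mathfrak h\oplus\mathfrak z$: here $\mathfrak n$ is a real inner product space with a two-step nilpotent Lie algebra structure, $\mathfrak z$ is its centre, $\mathfrak h=\mathfrak z^\perp$, and the maps $J_Z:\mathfrak h\to\mathfrak h$ ($Z\in\mathfrak z$) given by $\langle J_ZX,Y\rangle=\langle Z,[X,Y]\rangle$ satisfy $J_Z^2=-|Z|^2 I$. Elements of $N$ are written $(X,Z)$, with group law $(X,Z)(X',Z')=(X+X',Z+Z'+\frac12[X,X'])$. The Damek–Ricci space is $S=NA$ with $A\cong(0,\infty)$; points are $(X,Z,\varrho)$, $\varrho>0$, and $(X,Z,\varrho)(X',Z',\varrho')=(X+\varrho^{1/2}X',Z+\varrho Z'+\frac12\varrho^{1/2}[X,X'],\varrho\varrho')$.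 $\Delta_Z$ is the Euclidean Laplacian in the central variable $Z\in\mathfrak z$; $\mathcal L_0=\sum_jX_j^2$ is the sub-Laplacian on $N$, where $X_j$ are the left-invariant vector fields on $N$ corresponding to an orthonormal basis of $\mathfrak h$; $\partial_\varrho$ is differentiation in $\varrho$. ($\mathcal L_0$, $\Delta_Z$ commute with each other and with $\partial_\varrho$ and $\varrho$.) The operator $4\varrho[\varrho(\partial_{\varrho\varrho}+\Delta_Z)+\mathcal L_0-(Q-1)\partial_\varrho]$ is the Laplace–Beltrami operator of $S$. The product containing $\sqrt{-\Delta_Z}$ is understood by pairing the factors with indices $j$ and $k+1-j$, so that only $(\sqrt{-\Delta_Z})^2=-\Delta_Z$ occurs: writing $A=\varrho\partial_{\varrho\varrho}+a\partial_\varrho+\varrho\Delta_Z+\mathcal L_0$, it equals $\prod_{j=1}^{k/2}\big(A^2+(2j-1)^2\Delta_Z\big)$ if $k$ is even and $A\prod_{j=1}^{(k-1)/2}\big(A^2+4j^2\Delta_Z\big)$ if $k$ is odd. *)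

theory Defs
  imports "HOL-Analysis.Analysis"
begin

definition two_step_lie_bracket :: "('n::euclidean_space \<Rightarrow> 'n \<Rightarrow> 'n) \<Rightarrow> bool" where
  "two_step_lie_bracket br \<longleftrightarrow>
     bilinear br \<and> (\<forall>U. br U U = 0) \<and>
     (\<forall>U V W. br U (br V W) + br V (br W U) + br W (br U V) = 0) \<and>
     (\<forall>U V W. br (br U V) W = 0)"

definition lie_centre :: "('n::euclidean_space \<Rightarrow> 'n \<Rightarrow> 'n) \<Rightarrow> 'n set" where
  "lie_centre br = {Z. \<forall>U. br Z U = 0}"

definition horizontal :: "('n::euclidean_space \<Rightarrow> 'n \<Rightarrow> 'n) \<Rightarrow> 'n set" where
  "horizontal br = orthogonal_comp (lie_centre br)"

definition J_map :: "('n::euclidean_space \<Rightarrow> 'n \<Rightarrow> 'n) \<Rightarrow> 'n \<Rightarrow> 'n \<Rightarrow> 'n" where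
  "J_map br Z X = (THE W. W \<in> horizontal br \<and> (\<forall>Y\<in>horizontal br. W \<bullet> Y = Z \<bullet> br X Y))"

definition heisenberg_type :: "('n::euclidean_space \<Rightarrow> 'n \<Rightarrow> 'n) \<Rightarrow> bool" where
  "heisenberg_type br \<longleftrightarrow> two_step_lie_bracket br \<and>
     (\<forall>Z\<in>lie_centre br. \<forall>X\<in>horizontal br. J_map br Z (J_map br Z X) = - ((norm Z)\<^sup>2 *\<^sub>R X))"

definition homogeneous_dim :: "('n::euclidean_space \<Rightarrow> 'n \<Rightarrow> 'n) \<Rightarrow> real" where
  "homogeneous_dim br = real (dim (horizontal br)) / 2 + real (dim (lie_centre br))"

definition orthonormal_basis_of :: "'n::euclidean_space set \<Rightarrow> 'n set \<Rightarrow> bool" where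
  "orthonormal_basis_of B W \<longleftrightarrow>
     pairwise orthogonal B \<and> (\<forall>b\<in>B. norm b = 1) \<and> span B = W"

text \<open>The group \<open>N\<close> is modelled on its Lie algebra: \<open>(X, Z)\<close> is the vector \<open>U = X + Z\<close>.
  As \<open>[X + Z, X' + Z'] = [X, X']\<close> is central, the product below is
  \<open>(X + X', Z + Z' + [X, X'] / 2)\<close>. A point \<open>(X, Z, r)\<close> of \<open>S = NA\<close> is the pair
  \<open>(X + Z, r)\<close> with \<open>r > 0\<close>.\<close>

definition N_mult :: "('n::euclidean_space \<Rightarrow> 'n \<Rightarrow> 'n) \<Rightarrow> 'n \<Rightarrow> 'n \<Rightarrow> 'n" where
  "N_mult br U V = U + V + (1/2) *\<^sub>R br U V"

definition DR_space :: "('n::euclidean_space \<times> real) set" where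
  "DR_space = UNIV \<times> {0<..}"

text \<open>\<open>C\<^sup>m\<close> and \<open>C\<^sup>\<infinity>\<close> on an open set \<open>S\<close>.\<close>

primrec Ck_on :: "nat \<Rightarrow> 'a::euclidean_space set \<Rightarrow> ('a \<Rightarrow> complex) \<Rightarrow> bool" where
  "Ck_on 0 S f \<longleftrightarrow> continuous_on S f"
| "Ck_on (Suc m) S f \<longleftrightarrow> (\<forall>x\<in>S. f differentiable (at x)) \<and>
     (\<forall>v. Ck_on m S (\<lambda>x. frechet_derivative f (at x) v))"

definition smooth_fun_on :: "'a::euclidean_space set \<Rightarrow> ('a \<Rightarrow> complex) \<Rightarrow> bool" where
  "smooth_fun_on S f \<longleftrightarrow> (\<forall>m. Ck_on m S f)"

text \<open>Operators act on total functions; since \<open>DR_space\<close> is open, their values there depend only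
  on the restriction of the function to \<open>DR_space\<close>.\<close>

type_synonym 'n fn = "'n \<times> real \<Rightarrow> complex"

definition d_rho :: "'n fn \<Rightarrow> 'n fn" where
  "d_rho f = (\<lambda>(U, r). vector_derivative (\<lambda>s. f (U, s)) (at r))"

definition d_dir :: "'n::euclidean_space \<Rightarrow> 'n fn \<Rightarrow> 'n fn" where
  "d_dir V f = (\<lambda>(U, r). vector_derivative (\<lambda>t. f (U + t *\<^sub>R V, r)) (at 0))"

text \<open>The left-invariant field on \<open>N\<close> generated by \<open>V\<close>; \<open>t \<mapsto> t V\<close> is its one-parameter group.\<close>

definition left_inv_field ::
  "('n::euclidean_space \<Rightarrow> 'n \<Rightarrow> 'n) \<Rightarrow> 'n \<Rightarrow> 'n fn \<Rightarrow> 'n fn" where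
  "left_inv_field br V f =
     (\<lambda>(U, r). vector_derivative (\<lambda>t. f (N_mult br U (t *\<^sub>R V), r)) (at 0))"

text \<open>\<open>E\<close> and \<open>F\<close> stand for orthonormal bases of \<open>horizontal br\<close> and \<open>lie_centre br\<close>.\<close>

definition sub_laplacian ::
  "('n::euclidean_space \<Rightarrow> 'n \<Rightarrow> 'n) \<Rightarrow> 'n set \<Rightarrow> 'n fn \<Rightarrow> 'n fn" where
  "sub_laplacian br E f = (\<lambda>p. \<Sum>e\<in>E. left_inv_field br e (left_inv_field br e f) p)"

definition laplacian_Z :: "'n::euclidean_space set \<Rightarrow> 'n fn \<Rightarrow> 'n fn" where
  "laplacian_Z F f = (\<lambda>p. \<Sum>e\<in>F. d_dir e (d_dir e f) p)"

definition rho_pow :: "real \<Rightarrow> 'n fn \<Rightarrow> 'n fn" where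
  "rho_pow s f = (\<lambda>(U, r). (r powr s) *\<^sub>R f (U, r))"

text \<open>\<open>op_prod T m\<close> is the composition \<open>T 1 \<circ> T 2 \<circ> \<dots> \<circ> T m\<close>.\<close>

primrec op_prod :: "(nat \<Rightarrow> 'n fn \<Rightarrow> 'n fn) \<Rightarrow> nat \<Rightarrow> 'n fn \<Rightarrow> 'n fn" where
  "op_prod T 0 = id"
| "op_prod T (Suc m) = op_prod T m \<circ> T (Suc m)"

definition op_A ::
  "('n::euclidean_space \<Rightarrow> 'n \<Rightarrow> 'n) \<Rightarrow> 'n set \<Rightarrow> 'n set \<Rightarrow> real \<Rightarrow> 'n fn \<Rightarrow> 'n fn" where
  "op_A br E F a f = (\<lambda>(U, r).
      r *\<^sub>R d_rho (d_rho f) (U, r) + a *\<^sub>R d_rho f (U, r)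
    + r *\<^sub>R laplacian_Z F f (U, r) + sub_laplacian br E f (U, r))"

definition op_A_sq_plus ::
  "('n::euclidean_space \<Rightarrow> 'n \<Rightarrow> 'n) \<Rightarrow> 'n set \<Rightarrow> 'n set \<Rightarrow> real \<Rightarrow> real \<Rightarrow> 'n fn \<Rightarrow> 'n fn" where
  "op_A_sq_plus br E F a c f =
     (\<lambda>p. op_A br E F a (op_A br E F a f) p + c\<^sup>2 *\<^sub>R laplacian_Z F f p)"

text \<open>The product over \<open>1 \<le> j \<le> k\<close> of \<open>A - (k + 1 - 2 j) \<surd>(-\<Delta>\<^sub>Z)\<close>, where \<open>A = op_A br E F a\<close>:
  the factors \<open>j\<close> and \<open>k + 1 - j\<close> combine to \<open>A\<^sup>2 + (k + 1 - 2 j)\<^sup>2 \<Delta>\<^sub>Z\<close>.\<close>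

definition paired_prod ::
  "('n::euclidean_space \<Rightarrow> 'n \<Rightarrow> 'n) \<Rightarrow> 'n set \<Rightarrow> 'n set \<Rightarrow> real \<Rightarrow> nat \<Rightarrow> 'n fn \<Rightarrow> 'n fn" where
  "paired_prod br E F a k =
     (if even k
      then op_prod (\<lambda>j. op_A_sq_plus br E F a (2 * real j - 1)) (k div 2)
      else op_A br E F a \<circ> op_prod (\<lambda>j. op_A_sq_plus br E F a (2 * real j)) ((k - 1) div 2))"

text \<open>A quarter of the Laplace--Beltrami operator of \<open>S\<close>.\<close>

definition quarter_LB ::
  "('n::euclidean_space \<Rightarrow> 'n \<Rightarrow> 'n) \<Rightarrow> 'n set \<Rightarrow> 'n set \<Rightarrow> 'n fn \<Rightarrow> 'n fn" where
  "quarter_LB br E F f = (\<lambda>(U, r).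
      r *\<^sub>R (r *\<^sub>R (d_rho (d_rho f) (U, r) + laplacian_Z F f (U, r))
           + sub_laplacian br E f (U, r)
           - (homogeneous_dim br - 1) *\<^sub>R d_rho f (U, r)))"

end

theory Submission
  imports Defs
begin

text \<open>Write \<open>A\<^sub>c = \<rho> \<partial>\<^sub>\<rho>\<^sub>\<rho> + c \<partial>\<^sub>\<rho> + \<rho> \<Delta>\<^sub>Z + \<L>\<^sub>0\<close>. Each factor on the right-hand side is
  \<open>\<rho>\<^bsup>1 - t\<^esup> A\<^sub>c \<rho>\<^bsup>t\<^esup>\<close> with \<open>c = a - k - 1 + 2 j\<close> and \<open>t = (1 - Q - c) / 2\<close>. These factors commute, and
  multiplied in decreasing order of \<open>j\<close> they telescope, so it remains to see that
  \<open>A\<^bsub>a+k-1\<^esub> A\<^bsub>a+k-3\<^esub> \<dots> A\<^bsub>a-k+1\<^esub> = \<Prod>\<^sub>j (A\<^sub>a - (k + 1 - 2 j) s)\<close> with \<open>s\<^sup>2 = - \<Delta>\<^sub>Z\<close>. This follows by induction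
  from \<open>\<partial>\<^sub>\<rho> A\<^sub>a = A\<^sub>a \<partial>\<^sub>\<rho> + \<partial>\<^sub>\<rho>\<^sub>\<rho> - s\<^sup>2\<close>, that is \<open>v A\<^sub>a = (A\<^sub>a + v + 2 s) v\<close> for \<open>v = \<partial>\<^sub>\<rho> - s\<close>.\<close>

section \<open>The operator identity\<close>

text \<open>The coefficients run through \<open>c, c + 2, ...\<close>, the latest factor being
  outermost. For \<open>c = 1 - real n\<close> they are the numbers \<open>-(n + 1 - 2 j)\<close>,
  so this is the unpaired product, with \<open>s\<close> in the role of the square root.\<close>

primrec lin_prod :: "('w::real_vector \<Rightarrow> 'w) \<Rightarrow> ('w \<Rightarrow> 'w) \<Rightarrow> real \<Rightarrow> nat \<Rightarrow> 'w \<Rightarrow> 'w" where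
  "lin_prod B s c 0 x = x"
| "lin_prod B s c (Suc n) x = B (lin_prod B s c n x) + (c + 2 * real n) *\<^sub>R s (lin_prod B s c n x)"

lemma linear_lin_prod:
  assumes "linear B" "linear s"
  shows "linear (lin_prod B s c n)"
proof (induction n)
  case 0
  show ?case by (simp add: linear_iff)
next
  case (Suc n)
  interpret B: linear B by fact
  interpret s: linear s by fact
  interpret p: linear "lin_prod B s c n" by fact
  show ?case
    by (simp add: linear_iff B.add s.add p.add B.scale s.scale p.scale algebra_simps)
qed

text \<open>Models \<open>B = A a\<close>, \<open>d\<close> the derivative in rho and
  \<open>s\<close> a root of minus the central Laplacian. In \<open>d_B\<close> the term
  \<open>- s (s x)\<close> is that Laplacian, which appears when the derivative hits the coefficient
  rho.\<close>

locale shifted_commutation =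
  fixes B d s :: "'w::real_vector \<Rightarrow> 'w"
  assumes linear_B: "linear B" and linear_d: "linear d" and linear_s: "linear s"
    and s_B: "s (B x) = B (s x)"
    and s_d: "s (d x) = d (s x)"
    and d_B: "d (B x) = B (d x) + d (d x) - s (s x)"
begin

sublocale B: linear B by (rule linear_B)
sublocale d: linear d by (rule linear_d)
sublocale s: linear s by (rule linear_s)

lemmas lin_simps = B.add B.diff B.scale B.neg B.zero d.add d.diff d.scale d.neg d.zero
  s.add s.diff s.scale s.neg s.zero

sublocale p: linear "lin_prod B s c n" for c n
  by (rule linear_lin_prod[OF linear_B linear_s])

lemma lin_prod_B: "lin_prod B s c n (B x) = B (lin_prod B s c n x)"
  by (induction n arbitrary: x) (simp_all add: lin_simps s_B)

lemma lin_prod_s: "lin_prod B s c n (s x) = s (lin_prod B s c n x)"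
  by (induction n arbitrary: x) (simp_all add: lin_simps s_B)

text \<open>The recursion of \<open>lin_prod\<close> splits off the outermost factor; this form
  splits off the innermost one, so the remaining progression starts at \<open>c + 2\<close>.\<close>

lemma lin_prod_Suc_shift:
  "lin_prod B s c (Suc n) x = lin_prod B s (c + 2) n (B x + c *\<^sub>R s x)"
proof (induction n)
  case 0
  show ?case by simp
next
  case (Suc n)
  let ?y = "lin_prod B s (c + 2) n (B x + c *\<^sub>R s x)"
  have "lin_prod B s c (Suc (Suc n)) x = B ?y + (c + 2 * real (Suc n)) *\<^sub>R s ?y"
    by (simp only: lin_prod.simps(2)[of B s c "Suc n"] Suc.IH)
  then show ?case by (simp add: algebra_simps)
qed

text \<open>The outermost and innermost coefficients are \<open>n + 1\<close> and
  \<open>-(n + 1)\<close>. As \<open>B\<close> and \<open>s\<close> commute, the two factors combine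
  to a difference of squares, which contains \<open>s\<close> only through its square.\<close>

lemma lin_prod_Suc_Suc:
  "lin_prod B s (- real (Suc n)) (Suc (Suc n)) x
    = lin_prod B s (1 - real n) n (B (B x) - (real (Suc n))\<^sup>2 *\<^sub>R s (s x))"
proof -
  let ?c = "- real (Suc n)"
  let ?y = "B x + ?c *\<^sub>R s x"
  let ?p = "lin_prod B s (1 - real n) n"
  have c2: "?c + 2 = 1 - real n" by simp
  have "lin_prod B s ?c (Suc (Suc n)) x
      = B (lin_prod B s ?c (Suc n) x) + real (Suc n) *\<^sub>R s (lin_prod B s ?c (Suc n) x)"
    by (subst lin_prod.simps(2)) (simp add: algebra_simps)
  also have "\<dots> = B (?p ?y) + real (Suc n) *\<^sub>R s (?p ?y)"
    by (simp only: lin_prod_Suc_shift c2)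
  \<comment> \<open>The outermost factor is moved through the middle ones to meet the
    innermost.\<close>
  also have "\<dots> = ?p (B ?y + real (Suc n) *\<^sub>R s ?y)"
    by (simp only: p.add p.scale lin_prod_B lin_prod_s)
  also have "B ?y + real (Suc n) *\<^sub>R s ?y = B (B x) - (real (Suc n))\<^sup>2 *\<^sub>R s (s x)"
    by (simp add: lin_simps s_B power2_eq_square algebra_simps del: of_nat_Suc)
  finally show ?thesis .
qed

abbreviation v where "v x \<equiv> d x - s x"
text \<open>For \<open>B = A a\<close> this is \<open>A (a - 1)\<close>.\<close>

abbreviation B' where "B' x \<equiv> B x - d x"

text \<open>The map \<open>v\<close> intertwines the factor \<open>B' + (e + 1) s = B + e s - v\<close> with \<open>B + (e + 2) s\<close>,
  which is a factor of the same shape two steps further.\<close>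

lemma v_factor: "v (B' y + (e + 1) *\<^sub>R s y) = B (v y) + (e + 2) *\<^sub>R s (v y)"
  by (simp add: lin_simps d_B s_B s_d algebra_simps scaleR_2)

text \<open>\<open>v\<close> passes through the factors one at a time by \<open>v_factor\<close>,
  each time turning \<open>B'\<close> into \<open>B\<close> and raising the coefficient of
  \<open>s\<close> by one.\<close>

lemma v_lin_prod:
  "v (lin_prod B' s (c + 1) n x) = lin_prod B s (c + 2) n (v x)"
proof (induction n)
  case 0
  show ?case by simp
next
  case (Suc n)
  let ?y = "lin_prod B' s (c + 1) n x"
  have e: "c + 1 + 2 * real n = c + 2 * real n + 1" by simp
  have "v (lin_prod B' s (c + 1) (Suc n) x) = v (B' ?y + (c + 2 * real n + 1) *\<^sub>R s ?y)"
    unfolding lin_prod.simps(2) e ..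
  also have "\<dots> = B (v ?y) + (c + 2 * real n + 2) *\<^sub>R s (v ?y)"
    by (rule v_factor)
  also have "\<dots> = lin_prod B s (c + 2) (Suc n) (v x)"
    unfolding Suc.IH by (simp add: add.commute add.left_commute)
  finally show ?case .
qed

text \<open>Each factor on the left is a factor \<open>B + e s\<close> minus \<open>v\<close>. Once
  \<open>v\<close> has been pushed to the right, every factor contributes the same correction, which
  explains the multiplicity \<open>Suc n\<close>.\<close>

lemma lin_prod_shifted:
  "lin_prod B' s (c + 1) (Suc n) x
    = lin_prod B s c (Suc n) x - real (Suc n) *\<^sub>R lin_prod B s (c + 2) n (v x)"
proof (induction n)
  case 0
  show ?case by (simp add: algebra_simps)
next
  case (Suc n)
  let ?y = "lin_prod B' s (c + 1) (Suc n) x"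
  let ?F = "\<lambda>y. B y + (c + 2 * real (Suc n)) *\<^sub>R s y"
  \<comment> \<open>The new coefficient exceeds that in \<open>?F\<close> by one; the surplus
    \<open>s\<close> and the \<open>- d\<close> of \<open>B'\<close> make up
    \<open>- v\<close>.\<close>
  have "lin_prod B' s (c + 1) (Suc (Suc n)) x = ?F ?y - v ?y"
    unfolding lin_prod.simps(2)[of _ _ _ "Suc n"] by (simp add: scaleR_add_left del: lin_prod.simps of_nat_Suc)
  also have "v ?y = lin_prod B s (c + 2) (Suc n) (v x)"
    by (rule v_lin_prod)
  also have "?F ?y = ?F (lin_prod B s c (Suc n) x)
      - real (Suc n) *\<^sub>R ?F (lin_prod B s (c + 2) n (v x))"
    unfolding Suc.IH by (simp add: lin_simps algebra_simps del: lin_prod.simps of_nat_Suc)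
  also have "?F (lin_prod B s c (Suc n) x) = lin_prod B s c (Suc (Suc n)) x"
    by (rule lin_prod.simps(2)[symmetric])
  also have "?F (lin_prod B s (c + 2) n (v x)) = lin_prod B s (c + 2) (Suc n) (v x)"
    by (simp add: algebra_simps)
  finally show ?case
    unfolding of_nat_Suc[of "Suc n"] scaleR_add_left
    by (simp add: algebra_simps del: lin_prod.simps of_nat_Suc)
qed

text \<open>The induction step of the factorisation: for \<open>B = A a\<close> the outer operator
  \<open>B + n d\<close> is \<open>A (a + n)\<close>, and the inner product belongs to
  \<open>A (a - 1)\<close>.\<close>

lemma lin_prod_peel:
  "lin_prod B s (- real n) (Suc n) x
    = B (lin_prod B' s (1 - real n) n x) + real n *\<^sub>R d (lin_prod B' s (1 - real n) n x)"
proof (cases n)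
  case 0
  then show ?thesis by simp
next
  case (Suc m)
  let ?y = "lin_prod B' s (1 - real n) n x"
  let ?F = "\<lambda>y. B y + real n *\<^sub>R s y"
  have y: "?y = lin_prod B s (- real n) n x - real n *\<^sub>R lin_prod B s (2 - real n) m (v x)"
    using lin_prod_shifted[of "- real n" m x] unfolding Suc by (simp add: algebra_simps del: lin_prod.simps)
  have vy: "v ?y = lin_prod B s (2 - real n) n (v x)"
    using v_lin_prod[of "- real n" n x] by (simp add: algebra_simps)
  \<comment> \<open>Writing \<open>d = v + s\<close> gives the top factor \<open>?F\<close> of the
    progression from \<open>-n\<close>, plus \<open>n v\<close>. The latter cancels the correction
    term that \<open>lin_prod_shifted\<close> produces in \<open>?y\<close>.\<close>
  have "B ?y + real n *\<^sub>R d ?y = ?F ?y + real n *\<^sub>R v ?y"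
    by (simp add: algebra_simps del: lin_prod.simps)
  also have "?F ?y = ?F (lin_prod B s (- real n) n x) - real n *\<^sub>R ?F (lin_prod B s (2 - real n) m (v x))"
    unfolding y by (simp add: lin_simps algebra_simps del: lin_prod.simps)
  also have "?F (lin_prod B s (- real n) n x) = lin_prod B s (- real n) (Suc n) x"
    by (subst lin_prod.simps(2)) (simp add: algebra_simps)
  also have "?F (lin_prod B s (2 - real n) m (v x)) = lin_prod B s (2 - real n) n (v x)"
    unfolding Suc by (subst lin_prod.simps(2)) (simp add: algebra_simps)
  also note vy[symmetric]
  finally show ?thesis by simp
qed

end

section \<open>Radial operators and conjugation by powers of rho\<close>

primrec comp_prod :: "(nat \<Rightarrow> 'v \<Rightarrow> 'v) \<Rightarrow> nat \<Rightarrow> 'v \<Rightarrow> 'v" where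
  "comp_prod T 0 = id"
| "comp_prod T (Suc n) = comp_prod T n \<circ> T (Suc n)"

lemma comp_prod_Suc_left:
  assumes "\<And>i j x. T i (T j x) = T j (T i x)"
  shows "comp_prod T (Suc n) x = T (Suc n) (comp_prod T n x)"
proof -
  have "comp_prod T n (T j x) = T j (comp_prod T n x)" for j
    by (induction n arbitrary: x) (simp_all add: assms[of _ j])
  then show ?thesis by simp
qed

text \<open>\<open>P t\<close> is multiplication by the power \<open>t\<close> of rho,
  \<open>d\<close> the derivative in rho, \<open>D\<close> the central Laplacian and
  \<open>L\<close> the sub-Laplacian. The identity is derived from these relations alone, by
  algebra.\<close>

locale radial_operators =
  fixes P :: "real \<Rightarrow> 'v::real_vector \<Rightarrow> 'v" and d D L :: "'v \<Rightarrow> 'v"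
  assumes linear_P: "linear (P t)" and linear_d: "linear d"
    and linear_D: "linear D" and linear_L: "linear L"
    and P_P: "P t (P u x) = P (t + u) x" and P_0: "P 0 x = x"
    and d_P: "d (P t x) = P t (d x) + t *\<^sub>R P (t - 1) x"
    and D_P: "D (P t x) = P t (D x)" and L_P: "L (P t x) = P t (L x)"
    and D_d: "D (d x) = d (D x)" and L_d: "L (d x) = d (L x)"
    and D_L: "D (L x) = L (D x)"
begin

sublocale P: linear "P t" for t by (rule linear_P)
sublocale d: linear d by (rule linear_d)
sublocale D: linear D by (rule linear_D)
sublocale L: linear L by (rule linear_L)

lemmas lin_simps = P.add P.diff P.scale P.neg P.zero d.add d.diff d.scale d.neg d.zero
  D.add D.diff D.scale D.neg D.zero L.add L.diff L.scale L.neg L.zero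

definition A :: "real \<Rightarrow> 'v \<Rightarrow> 'v" where
  "A a x = P 1 (d (d x)) + a *\<^sub>R d x + P 1 (D x) + L x"

definition M :: "real \<Rightarrow> 'v \<Rightarrow> 'v" where
  "M Q x = P 1 (P 1 (d (d x) + D x) + L x - (Q - 1) *\<^sub>R d x)"

lemma linear_A: "linear (A a)"
  by (rule linearI) (simp_all add: A_def lin_simps algebra_simps)

lemma linear_M: "linear (M Q)"
  by (rule linearI) (simp_all add: M_def lin_simps algebra_simps)

lemma A_shift: "A (a + t) x = A a x + t *\<^sub>R d x"
  by (simp add: A_def algebra_simps)

lemma d_A: "d (A a x) = A a (d x) + d (d x) + D x"
  by (simp add: A_def lin_simps d_P D_d L_d P_0)

lemma D_A: "D (A a x) = A a (D x)"
  by (simp add: A_def lin_simps D_P D_d D_L)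

text \<open>The Leibniz rule \<open>d_P\<close>, applied twice: the second derivative yields
  \<open>2 t\<close> in first order and \<open>t (t - 1)\<close> in order zero, the term
  \<open>c d\<close> yields \<open>c\<close> and \<open>c t\<close>. With
  \<open>2 t + c = 1 - Q\<close> the differential part becomes \<open>M Q\<close>.\<close>

lemma conj_A:
  "P (1 - t) (A c (P t x))
    = P 1 (P 1 (d (d x) + D x) + L x + (2 * t + c) *\<^sub>R d x) + (t * (t - 1 + c)) *\<^sub>R x"
proof -
  have "(2 * t) *\<^sub>R y = t *\<^sub>R y + t *\<^sub>R y" for y :: 'v
    by (metis mult_2 scaleR_add_left)
  then show ?thesis
    by (simp add: A_def lin_simps d_P D_P L_P P_P P_0 algebra_simps)
qed

text \<open>A square root of \<open>-D\<close> is adjoined by passing to pairs: \<open>(x, y)\<close> stands for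
  \<open>x + \<surd>(-D) y\<close>.\<close>

definition root :: "'v \<times> 'v \<Rightarrow> 'v \<times> 'v" where
  "root = (\<lambda>(x, y). (- D y, x))"

definition paired :: "real \<Rightarrow> nat \<Rightarrow> 'v \<Rightarrow> 'v" where
  "paired a k =
     (if even k
      then comp_prod (\<lambda>j x. A a (A a x) + (2 * real j - 1)\<^sup>2 *\<^sub>R D x) (k div 2)
      else A a \<circ> comp_prod (\<lambda>j x. A a (A a x) + (2 * real j)\<^sup>2 *\<^sub>R D x) ((k - 1) div 2))"

text \<open>On pairs the square of \<open>root\<close> is \<open>- D\<close> in each component, so
  \<open>d_A\<close> takes the form \<open>d_B\<close>; \<open>root\<close> commutes with the other
  two maps because \<open>D\<close> does.\<close>

lemma shifted_commutation_A:
  "shifted_commutation (map_prod (A a) (A a)) (map_prod d d) root"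
proof -
  interpret A: linear "A a" by (rule linear_A)
  show ?thesis
    by unfold_locales
      (auto simp: root_def D_A D_d d_A lin_simps A.add A.scale A.neg split: prod.splits)
qed

lemma paired_Suc_Suc:
  "paired a (Suc (Suc n)) x = paired a n (A a (A a x) + (real (Suc n))\<^sup>2 *\<^sub>R D x)"
proof (cases "even n")
  case True
  then show ?thesis by (auto simp: paired_def elim!: evenE)
next
  case False
  have "(2 + real b * 2)\<^sup>2 = 4 * (1 + real b)\<^sup>2" for b
    by (simp add: power2_eq_square algebra_simps)
  with False show ?thesis by (auto simp: paired_def power_mult_distrib algebra_simps elim!: oddE)
qed

text \<open>Induction in steps of two: both sides split off the same innermost factor
  \<open>A a (A a x) + (n + 1)^2 D x\<close>. It acts componentwise, so the second component stays
  0.\<close>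

lemma lin_prod_eq_paired:
  "lin_prod (map_prod (A a) (A a)) root (1 - real n) n (x, 0) = (paired a n x, 0)"
proof (induction n arbitrary: x rule: induct_nat_012)
  case (ge2 n)
  interpret A: linear "A a" by (rule linear_A)
  interpret shifted_commutation "map_prod (A a) (A a)" "map_prod d d" root
    by (rule shifted_commutation_A)
  have "1 - real (Suc (Suc n)) = - real (Suc n)" by simp
  then show ?case
    using lin_prod_Suc_Suc[of n "(x, 0)"] ge2(1)[of "A a (A a x) + (real (Suc n))\<^sup>2 *\<^sub>R D x"]
    by (simp add: root_def paired_Suc_Suc D.zero A.zero del: lin_prod.simps)
qed (use linear_0[OF linear_A] in \<open>simp_all add: paired_def root_def D.zero\<close>)

text \<open>The first component of \<open>lin_prod_peel\<close>. Iterated, it writes the paired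
  product as \<open>A (a + k - 1)\<close>, \<open>A (a + k - 3)\<close>, ...,
  \<open>A (a - k + 1)\<close>, from left to right.\<close>

lemma paired_Suc:
  "paired a (Suc n) x = A (a + real n) (paired (a - 1) n x)"
proof -
  interpret A: linear "A a" by (rule linear_A)
  interpret shifted_commutation "map_prod (A a) (A a)" "map_prod d d" root
    by (rule shifted_commutation_A)
  have B': "(\<lambda>x. map_prod (A a) (A a) x - map_prod d d x) = map_prod (A (a - 1)) (A (a - 1))"
    using A_shift[of "a" "-1"] by (auto simp: fun_eq_iff)
  have "(paired a (Suc n) x, 0::'v) = lin_prod (map_prod (A a) (A a)) root (- real n) (Suc n) (x, 0)"
    using lin_prod_eq_paired[of a "Suc n" x] by simp
  also have "\<dots> = (A (a + real n) (paired (a - 1) n x), 0)"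
    unfolding lin_prod_peel B' lin_prod_eq_paired by (simp add: A_shift A.zero d.zero)
  finally show ?thesis by simp
qed

theorem conj_paired:
  "P ((real k + Q + a) / 2) (paired a k (P ((real k - Q - a) / 2) x))
    = comp_prod (\<lambda>j x. M Q x + (Q\<^sup>2 / 4 - (a - real k + 2 * real j - 2)\<^sup>2 / 4) *\<^sub>R x) k x"
proof -
  \<comment> \<open>The parameter \<open>m\<close> will be \<open>a - k - 1\<close>. It does not
    change when \<open>a\<close> and \<open>k\<close> both drop by one, so the induction keeps the
    same family of factors.\<close>
  define T where "T m j x = M Q x + (Q\<^sup>2 / 4 - (m + 2 * real j - 1)\<^sup>2 / 4) *\<^sub>R x" for m j x
  interpret M: linear "M Q" by (rule linear_M)
  have T: "T m j x = P (1 - (1 - Q - c) / 2) (A c (P ((1 - Q - c) / 2) x))"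
    if c: "c = m + 2 * real j" for m j c x
  proof -
    \<comment> \<open>The solution of \<open>2 t + c = 1 - Q\<close>, as needed in
      \<open>conj_A\<close>; the zeroth-order term is then
      \<open>(Q^2 - (c - 1)^2) / 4\<close>.\<close>
    define t where "t = (1 - Q - c) / 2"
    have t: "2 * t + c = 1 - Q"
      by (simp add: t_def field_simps)
    have t': "t * (t - 1 + c) = Q\<^sup>2 / 4 - (m + 2 * real j - 1)\<^sup>2 / 4"
      unfolding c[symmetric] by (simp add: t_def field_simps power2_eq_square)
    have M: "M Q x = P 1 (P 1 (d (d x) + D x) + L x + (1 - Q) *\<^sub>R d x)"
      by (simp add: M_def algebra_simps)
    show ?thesis
      unfolding t_def[symmetric] unfolding conj_A t t' T_def M ..
  qed
  \<comment> \<open>All factors are \<open>M Q\<close> plus a multiple of the identity. This allows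
    factor \<open>Suc k\<close>, innermost in \<open>comp_prod\<close>, to be taken to the
    outside.\<close>
  have comm: "T m i (T m j x) = T m j (T m i x)" for m i j x
  proof -
    have "M Q (M Q x + u *\<^sub>R x) + w *\<^sub>R (M Q x + u *\<^sub>R x)
        = M Q (M Q x + w *\<^sub>R x) + u *\<^sub>R (M Q x + w *\<^sub>R x)" for u w
      by (simp add: M.add M.scale algebra_simps)
    then show ?thesis unfolding T_def .
  qed
  have "P ((real k + Q + a) / 2) (paired a k (P ((real k - Q - a) / 2) x))
    = comp_prod (T (a - real k - 1)) k x" for k
  proof (induction k arbitrary: a)
    case 0
    show ?case by (simp add: paired_def P_P P_0 field_simps)
  next
    case (Suc k)
    let ?c = "a + real k"
    let ?y = "P ((real (Suc k) - Q - a) / 2) x"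
    let ?z = "paired (a - 1) k ?y"
    let ?T = "T (a - real (Suc k) - 1)"
    have "?T = T (a - 1 - real k - 1)"
      by (simp add: algebra_simps)
    moreover have "?y = P ((real k - Q - (a - 1)) / 2) x"
      by (simp add: algebra_simps)
    ultimately have IH: "P ((real k + Q + (a - 1)) / 2) ?z = comp_prod ?T k x"
      using Suc.IH[of "a - 1"] by simp
    have "comp_prod ?T (Suc k) x = ?T (Suc k) (comp_prod ?T k x)"
      by (rule comp_prod_Suc_left) (rule comm)
    also have "\<dots> = ?T (Suc k) (P ((real k + Q + (a - 1)) / 2) ?z)"
      unfolding IH ..
    also have "\<dots> = P (1 - (1 - Q - ?c) / 2) (A ?c (P ((1 - Q - ?c) / 2 + (real k + Q + (a - 1)) / 2) ?z))"
      by (subst T[of "?c"]) (simp_all add: P_P)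
    \<comment> \<open>The powers of rho between neighbouring factors cancel, so \<open>A ?c\<close>
      meets the shorter product directly and \<open>paired_Suc\<close> absorbs it.\<close>
    also have "(1 - Q - ?c) / 2 + (real k + Q + (a - 1)) / 2 = 0"
      by (simp add: field_simps)
    also have "1 - (1 - Q - ?c) / 2 = (real (Suc k) + Q + a) / 2"
      by (simp add: field_simps)
    finally show ?case by (simp add: P_0 paired_Suc)
  qed
  moreover have "T (a - real k - 1) = (\<lambda>j x. M Q x + (Q\<^sup>2 / 4 - (a - real k + 2 * real j - 2)\<^sup>2 / 4) *\<^sub>R x)"
    by (simp add: T_def fun_eq_iff algebra_simps)
  ultimately show ?thesis by simp
qed

end

section \<open>Smooth functions and directional derivatives\<close>

text \<open>The second difference is the increment over \<open>[0, h]\<close> of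
  \<open>g (x + s v + h w) - g (x + s v)\<close> as a function of \<open>s\<close>. The mean value
  theorem is used in \<open>s\<close>, then along \<open>w\<close>.\<close>

lemma second_difference_mean_value:
  fixes g :: "'a::real_normed_vector \<Rightarrow> real"
  assumes h: "0 < h"
    and box: "\<And>s t. \<lbrakk>0 \<le> s; s \<le> h; 0 \<le> t; t \<le> h\<rbrakk> \<Longrightarrow> x + s *\<^sub>R v + t *\<^sub>R w \<in> S"
    and G: "\<And>y. y \<in> S \<Longrightarrow> (g has_derivative G y) (at y)"
    and H: "\<And>y. y \<in> S \<Longrightarrow> ((\<lambda>y. G y v) has_derivative H y) (at y)"
  obtains s t where "0 < s" "s < h" "0 < t" "t < h"
    "g (x + h *\<^sub>R v + h *\<^sub>R w) - g (x + h *\<^sub>R v) - g (x + h *\<^sub>R w) + g x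
      = h * (h * H (x + s *\<^sub>R v + t *\<^sub>R w) w)"
proof -
  have lin: "G y (c *\<^sub>R u) = c * G y u" "H y (c *\<^sub>R u) = c * H y u" if "y \<in> S" for y c u
    using linear_scale[OF has_derivative_linear[OF G[OF that]]]
      linear_scale[OF has_derivative_linear[OF H[OF that]]] by simp_all
  have "((\<lambda>s. g (x + s *\<^sub>R v + h *\<^sub>R w) - g (x + s *\<^sub>R v)) has_real_derivative
      G (x + s *\<^sub>R v + h *\<^sub>R w) v - G (x + s *\<^sub>R v) v) (at s)" if s: "0 \<le> s" "s \<le> h" for s
  proof -
    have S: "x + s *\<^sub>R v + h *\<^sub>R w \<in> S" "x + s *\<^sub>R v \<in> S"
      using box[of s h] box[of s 0] s h by simp_all
    have "((\<lambda>s. x + s *\<^sub>R v + h *\<^sub>R w) has_derivative (\<lambda>c. c *\<^sub>R v)) (at s)"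
      "((\<lambda>s. x + s *\<^sub>R v) has_derivative (\<lambda>c. c *\<^sub>R v)) (at s)"
      by (auto intro!: derivative_eq_intros)
    from has_derivative_diff[OF has_derivative_compose[OF this(1) G[OF S(1)]]
        has_derivative_compose[OF this(2) G[OF S(2)]]]
    show ?thesis
      unfolding has_field_derivative_def
      by (rule has_derivative_eq_rhs) (simp add: fun_eq_iff lin[OF S(1)] lin[OF S(2)] right_diff_distrib mult.commute)
  qed
  from MVT2[OF h this] obtain s where s: "0 < s" "s < h"
    "g (x + h *\<^sub>R v + h *\<^sub>R w) - g (x + h *\<^sub>R v) - (g (x + h *\<^sub>R w) - g x)
      = h * (G (x + s *\<^sub>R v + h *\<^sub>R w) v - G (x + s *\<^sub>R v) v)"
    by auto
  have "((\<lambda>t. G (x + s *\<^sub>R v + t *\<^sub>R w) v) has_real_derivative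
      H (x + s *\<^sub>R v + t *\<^sub>R w) w) (at t)" if t: "0 \<le> t" "t \<le> h" for t
  proof -
    have S: "x + s *\<^sub>R v + t *\<^sub>R w \<in> S"
      using box[of s t] s t by simp
    have "((\<lambda>t. x + s *\<^sub>R v + t *\<^sub>R w) has_derivative (\<lambda>c. c *\<^sub>R w)) (at t)"
      by (auto intro!: derivative_eq_intros)
    from has_derivative_compose[OF this H[OF S]] show ?thesis
      unfolding has_field_derivative_def
      by (rule has_derivative_eq_rhs) (simp add: fun_eq_iff lin[OF S] mult.commute)
  qed
  from MVT2[OF h this] obtain t where t: "0 < t" "t < h"
    "G (x + s *\<^sub>R v + h *\<^sub>R w) v - G (x + s *\<^sub>R v) v = h * H (x + s *\<^sub>R v + t *\<^sub>R w) w"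
    by auto
  show thesis
    using that[OF s(1,2) t(1,2)] s(3) t(3) by simp
qed

text \<open>One second difference equals \<open>h^2\<close> times a value of either mixed derivative
  at points near \<open>x\<close>; continuity then forces the values at \<open>x\<close> to
  agree.\<close>

lemma symmetric_second_derivative_real:
  fixes g :: "'a::real_normed_vector \<Rightarrow> real"
  assumes S: "open S" "x \<in> S"
    and G: "\<And>y. y \<in> S \<Longrightarrow> (g has_derivative G y) (at y)"
    and H: "\<And>y. y \<in> S \<Longrightarrow> ((\<lambda>y. G y v) has_derivative H y) (at y)"
    and K: "\<And>y. y \<in> S \<Longrightarrow> ((\<lambda>y. G y w) has_derivative K y) (at y)"
    and contH: "continuous_on S (\<lambda>y. H y w)" and contK: "continuous_on S (\<lambda>y. K y v)"
  shows "H x w = K x v"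
proof (rule ccontr)
  assume "H x w \<noteq> K x v"
  define e where "e = dist (H x w) (K x v) / 2"
  have e: "e > 0" using \<open>H x w \<noteq> K x v\<close> by (simp add: e_def)
  have "isCont (\<lambda>y. H y w) x" "isCont (\<lambda>y. K y v) x"
    using contH contK S by (simp_all add: continuous_on_eq_continuous_at)
  then have "\<forall>\<^sub>F y in nhds x. dist (H y w) (H x w) < e" "\<forall>\<^sub>F y in nhds x. dist (K y v) (K x v) < e"
    using e by (simp_all add: continuous_at_eps_delta eventually_nhds_metric)
  moreover have "\<forall>\<^sub>F y in nhds x. y \<in> S"
    using S by (rule eventually_nhds_in_open)
  ultimately have "\<forall>\<^sub>F y in nhds x. y \<in> S \<and> dist (H y w) (H x w) < e \<and> dist (K y v) (K x v) < e"
    by eventually_elim simp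
  then obtain r where r: "r > 0" and close: "\<And>y. dist y x < r \<Longrightarrow>
      y \<in> S \<and> dist (H y w) (H x w) < e \<and> dist (K y v) (K x v) < e"
    unfolding eventually_nhds_metric by blast
  \<comment> \<open>Small enough for the whole parallelogram to lie in the ball of radius
    \<open>r\<close>; the summand 1 keeps the denominator positive.\<close>
  define h where "h = r / (norm v + norm w + 1)"
  have pos: "norm v + norm w + 1 > 0" by (simp add: add_nonneg_pos)
  have h: "h > 0" using r pos by (simp add: h_def)
  have hr: "h * (norm v + norm w) < r"
    using r pos by (simp add: h_def field_simps)
  have box: "dist (x + s *\<^sub>R v + t *\<^sub>R w) x < r" if "0 \<le> s" "s \<le> h" "0 \<le> t" "t \<le> h" for s t
  proof -
    have "dist (x + s *\<^sub>R v + t *\<^sub>R w) x = norm (s *\<^sub>R v + t *\<^sub>R w)"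
      by (simp add: dist_norm add.assoc)
    also have "\<dots> \<le> s * norm v + t * norm w"
      using norm_triangle_ineq[of "s *\<^sub>R v" "t *\<^sub>R w"] that by simp
    also have "\<dots> \<le> h * norm v + h * norm w"
      using that by (intro add_mono mult_right_mono) simp_all
    finally show ?thesis using hr by (simp add: distrib_left)
  qed
  have box': "dist (x + t *\<^sub>R w + s *\<^sub>R v) x < r" if "0 \<le> s" "s \<le> h" "0 \<le> t" "t \<le> h" for s t
    using box[OF that] by (simp add: add.assoc add.commute[of "s *\<^sub>R v"])
  obtain s t where st: "0 < s" "s < h" "0 < t" "t < h"
    "g (x + h *\<^sub>R v + h *\<^sub>R w) - g (x + h *\<^sub>R v) - g (x + h *\<^sub>R w) + g x
      = h * (h * H (x + s *\<^sub>R v + t *\<^sub>R w) w)"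
    using second_difference_mean_value[where x = x and v = v and w = w and S = S, OF h _ G H] box close by blast
  obtain s' t' where st': "0 < s'" "s' < h" "0 < t'" "t' < h"
    "g (x + h *\<^sub>R w + h *\<^sub>R v) - g (x + h *\<^sub>R w) - g (x + h *\<^sub>R v) + g x
      = h * (h * K (x + s' *\<^sub>R w + t' *\<^sub>R v) v)"
    using second_difference_mean_value[where x = x and v = w and w = v and S = S, OF h _ G K] box' close by blast
  have "h * (h * H (x + s *\<^sub>R v + t *\<^sub>R w) w) = h * (h * K (x + s' *\<^sub>R w + t' *\<^sub>R v) v)"
    unfolding st(5)[symmetric] st'(5)[symmetric] by (simp add: algebra_simps)
  then have "H (x + s *\<^sub>R v + t *\<^sub>R w) w = K (x + s' *\<^sub>R w + t' *\<^sub>R v) v"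
    using h by simp
  moreover have "dist (H (x + s *\<^sub>R v + t *\<^sub>R w) w) (H x w) < e"
    "dist (K (x + s' *\<^sub>R w + t' *\<^sub>R v) v) (K x v) < e"
    using close box[of s t] box'[of t' s'] st st' by auto
  ultimately have "dist (H x w) (K x v) < 2 * e"
    using dist_triangle3[of "H x w" "K x v" "K (x + s' *\<^sub>R w + t' *\<^sub>R v) v"] by simp
  then show False by (simp add: e_def)
qed

section \<open>Directional derivatives and smoothness\<close>

definition pd :: "'a::euclidean_space \<Rightarrow> ('a \<Rightarrow> complex) \<Rightarrow> 'a \<Rightarrow> complex" where
  "pd v f = (\<lambda>x. frechet_derivative f (at x) v)"

lemma pd_eqI: "(f has_derivative f') (at x) \<Longrightarrow> pd v f x = f' v"
  unfolding pd_def by (metis frechet_derivative_at)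

lemma has_derivative_pd: "f differentiable (at x) \<Longrightarrow> (f has_derivative (\<lambda>v. pd v f x)) (at x)"
  unfolding pd_def frechet_derivative_works by simp

lemma Ck_on_Suc_iff:
  "Ck_on (Suc m) S f \<longleftrightarrow> (\<forall>x\<in>S. f differentiable (at x)) \<and> (\<forall>v. Ck_on m S (pd v f))"
  by (simp add: pd_def)

declare Ck_on.simps(2) [simp del]

lemma pd_cong:
  assumes "open S" "\<And>x. x \<in> S \<Longrightarrow> f x = g x" "x \<in> S" "f differentiable (at x)"
  shows "pd v g x = pd v f x" "g differentiable (at x)"
proof -
  have "(g has_derivative (\<lambda>v. pd v f x)) (at x)"
    using has_derivative_transform_within_open[OF has_derivative_pd[OF assms(4)] assms(1,3,2)] .
  then show "pd v g x = pd v f x" "g differentiable (at x)"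
    by (auto intro: pd_eqI differentiableI)
qed

lemma Ck_on_cong:
  assumes "open S" "\<And>x. x \<in> S \<Longrightarrow> f x = g x" "Ck_on m S f"
  shows "Ck_on m S g"
  using assms(2,3)
proof (induction m arbitrary: f g)
  case 0
  then show ?case by (simp cong: continuous_on_cong)
next
  case (Suc m)
  then have "x \<in> S \<Longrightarrow> f differentiable (at x)" for x by (simp add: Ck_on_Suc_iff)
  then have pd: "pd v g x = pd v f x" "g differentiable (at x)" if "x \<in> S" for v x
    using pd_cong[OF assms(1), of f g x] Suc.prems(1) that by auto
  have "Ck_on m S (pd v g)" for v
    by (rule Suc.IH[of "pd v f"]) (use Suc.prems(2) in \<open>simp_all add: pd Ck_on_Suc_iff\<close>)
  then show ?case using pd by (simp add: Ck_on_Suc_iff)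
qed

lemma Ck_on_Suc_imp: "Ck_on (Suc m) S f \<Longrightarrow> Ck_on m S f"
proof (induction m arbitrary: f)
  case 0
  then show ?case
    by (simp add: Ck_on_Suc_iff continuous_at_imp_continuous_on differentiable_imp_continuous_within)
next
  case (Suc m)
  then show ?case
    unfolding Ck_on_Suc_iff[of "Suc m"] by (subst Ck_on_Suc_iff) blast
qed

text \<open>Coinduction, with \<open>R\<close> as the invariant of an induction on the order. The
  function \<open>g\<close> has to agree with the derivative on \<open>S\<close> only, because
  closed formulas for derivatives may fail elsewhere.\<close>

lemma smooth_fun_onI:
  assumes "open S" "R f"
    and "\<And>f x. R f \<Longrightarrow> x \<in> S \<Longrightarrow> f differentiable (at x)"
    and "\<And>f v. R f \<Longrightarrow> \<exists>g. R g \<and> (\<forall>x\<in>S. pd v f x = g x)"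
  shows "smooth_fun_on S f"
proof -
  have "Ck_on m S f" if "R f" for m f
    using that
  proof (induction m arbitrary: f)
    case 0
    then show ?case
      using assms(3) by (simp add: continuous_at_imp_continuous_on differentiable_imp_continuous_within)
  next
    case (Suc m)
    have "Ck_on m S (pd v f)" for v
    proof -
      obtain g where "R g" "\<And>x. x \<in> S \<Longrightarrow> g x = pd v f x"
        using assms(4)[OF Suc.prems, of v] by metis
      then show ?thesis using Ck_on_cong[OF assms(1)] Suc.IH by blast
    qed
    then show ?case using assms(3)[OF Suc.prems] by (simp add: Ck_on_Suc_iff)
  qed
  then show ?thesis using assms(2) by (simp add: smooth_fun_on_def)
qed

lemma smooth_differentiable: "smooth_fun_on S f \<Longrightarrow> x \<in> S \<Longrightarrow> f differentiable (at x)"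
  using Ck_on_Suc_iff[of 0] by (auto simp: smooth_fun_on_def)

lemma smooth_pd:
  assumes "smooth_fun_on S f"
  shows "smooth_fun_on S (pd v f)"
proof -
  have "Ck_on (Suc m) S f" for m
    using assms by (simp add: smooth_fun_on_def)
  then show ?thesis by (simp add: Ck_on_Suc_iff smooth_fun_on_def)
qed

lemma smooth_cong:
  "open S \<Longrightarrow> (\<And>x. x \<in> S \<Longrightarrow> f x = g x) \<Longrightarrow> smooth_fun_on S f \<Longrightarrow> smooth_fun_on S g"
  unfolding smooth_fun_on_def using Ck_on_cong by blast

lemma smooth_continuous: "smooth_fun_on S f \<Longrightarrow> continuous_on S f"
  using Ck_on.simps(1)[of S f] by (simp only: smooth_fun_on_def)

lemma smooth_has_derivative:
  "smooth_fun_on S f \<Longrightarrow> x \<in> S \<Longrightarrow> (f has_derivative (\<lambda>v. pd v f x)) (at x)"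
  using has_derivative_pd smooth_differentiable by blast

lemma smooth_const: "smooth_fun_on S (\<lambda>x. c)"
proof -
  have "Ck_on m S (\<lambda>x. c)" for m
    by (induction m arbitrary: c) (simp_all add: Ck_on_Suc_iff pd_def)
  then show ?thesis by (simp add: smooth_fun_on_def)
qed

lemma pd_add:
  assumes "f differentiable (at x)" "g differentiable (at x)"
  shows "pd v (\<lambda>x. f x + g x) x = pd v f x + pd v g x"
  by (rule pd_eqI) (intro has_derivative_add has_derivative_pd assms)

lemma pd_mult:
  assumes "f differentiable (at x)" "g differentiable (at x)"
  shows "pd v (\<lambda>x. f x * g x) x = f x * pd v g x + pd v f x * g x"
  by (rule pd_eqI) (intro has_derivative_mult has_derivative_pd assms)

lemma Ck_on_add:
  assumes "open S"
  shows "Ck_on m S f \<Longrightarrow> Ck_on m S g \<Longrightarrow> Ck_on m S (\<lambda>x. f x + g x)"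
proof (induction m arbitrary: f g)
  case 0
  then show ?case by (simp add: continuous_on_add)
next
  case (Suc m)
  then have d: "x \<in> S \<Longrightarrow> f differentiable (at x)" "x \<in> S \<Longrightarrow> g differentiable (at x)" for x
    by (simp_all add: Ck_on_Suc_iff)
  have "Ck_on m S (\<lambda>x. pd v f x + pd v g x)" for v
    by (rule Suc.IH) (use Suc.prems in \<open>simp_all add: Ck_on_Suc_iff\<close>)
  then have "Ck_on m S (pd v (\<lambda>x. f x + g x))" for v
    by (rule Ck_on_cong[OF assms, rotated]) (simp add: pd_add d)
  then show ?case using d by (simp add: Ck_on_Suc_iff)
qed

lemma Ck_on_mult:
  assumes "open S"
  shows "Ck_on m S f \<Longrightarrow> Ck_on m S g \<Longrightarrow> Ck_on m S (\<lambda>x. f x * g x)"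
proof (induction m arbitrary: f g)
  case 0
  then show ?case by (simp add: continuous_on_mult)
next
  case (Suc m)
  then have d: "x \<in> S \<Longrightarrow> f differentiable (at x)" "x \<in> S \<Longrightarrow> g differentiable (at x)" for x
    by (simp_all add: Ck_on_Suc_iff)
  have "Ck_on m S (\<lambda>x. f x * pd v g x + pd v f x * g x)" for v
    by (intro Ck_on_add assms Suc.IH Ck_on_Suc_imp[OF Suc.prems(1)] Ck_on_Suc_imp[OF Suc.prems(2)])
      (use Suc.prems in \<open>simp_all add: Ck_on_Suc_iff\<close>)
  then have "Ck_on m S (pd v (\<lambda>x. f x * g x))" for v
    by (rule Ck_on_cong[OF assms, rotated]) (simp add: pd_mult d)
  then show ?case using d by (simp add: Ck_on_Suc_iff)
qed

lemma smooth_add: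
  "open S \<Longrightarrow> smooth_fun_on S f \<Longrightarrow> smooth_fun_on S g \<Longrightarrow> smooth_fun_on S (\<lambda>x. f x + g x)"
  unfolding smooth_fun_on_def using Ck_on_add by blast

lemma smooth_mult:
  "open S \<Longrightarrow> smooth_fun_on S f \<Longrightarrow> smooth_fun_on S g \<Longrightarrow> smooth_fun_on S (\<lambda>x. f x * g x)"
  unfolding smooth_fun_on_def using Ck_on_mult by blast

lemma pd_commute:
  assumes "open S" "smooth_fun_on S f" "x \<in> S"
  shows "pd v (pd w f) x = pd w (pd v f) x"
proof -
  have *: "pd v (pd w f) x \<bullet> c = pd w (pd v f) x \<bullet> c" for c
    by (rule symmetric_second_derivative_real[OF assms(1,3), where g = "\<lambda>y. f y \<bullet> c"
          and G = "\<lambda>y u. pd u f y \<bullet> c" and H = "\<lambda>y u. pd u (pd w f) y \<bullet> c" and K = "\<lambda>y u. pd u (pd v f) y \<bullet> c"])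
      (auto intro!: has_derivative_inner_left smooth_has_derivative smooth_pd assms continuous_intros smooth_continuous)
  \<comment> \<open>Inner products with 1 and the imaginary unit are the real and imaginary
    parts.\<close>
  show ?thesis using *[of 1] *[of \<i>] by (simp add: complex_eq_iff inner_complex_def)
qed

section \<open>Operators on smooth functions\<close>

lemma smooth_fun_onI_derivative:
  assumes "open S" "\<And>x. x \<in> S \<Longrightarrow> (f has_derivative f' x) (at x)"
    and "\<And>v. smooth_fun_on S (\<lambda>x. f' x v)"
  shows "smooth_fun_on S f"
proof -
  have "Ck_on m S f" for m
  proof (cases m)
    case 0
    show ?thesis
      unfolding 0 Ck_on.simps using assms(2)
      by (intro continuous_at_imp_continuous_on ballI has_derivative_continuous)
  next
    case (Suc n)
    have "Ck_on n S (pd v f)" for v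
      by (rule Ck_on_cong[OF assms(1) _ assms(3)[unfolded smooth_fun_on_def, rule_format]])
        (simp add: pd_eqI[OF assms(2)])
    then show ?thesis
      using assms(2) by (auto simp: Suc Ck_on_Suc_iff intro: differentiableI)
  qed
  then show ?thesis by (simp add: smooth_fun_on_def)
qed

lemma smooth_sum:
  assumes "open S" "\<And>i. i \<in> I \<Longrightarrow> smooth_fun_on S (f i)"
  shows "smooth_fun_on S (\<lambda>x. \<Sum>i\<in>I. f i x)"
  using assms(2)
  by (induction I rule: infinite_finite_induct) (simp_all add: smooth_const smooth_add assms(1))

lemma smooth_scaleR:
  "open S \<Longrightarrow> smooth_fun_on S f \<Longrightarrow> smooth_fun_on S (\<lambda>x. c *\<^sub>R f x)"
  unfolding scaleR_conv_of_real by (rule smooth_mult[OF _ smooth_const])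

lemma pd_sum:
  assumes "\<And>i. i \<in> I \<Longrightarrow> f i differentiable (at x)"
  shows "pd v (\<lambda>x. \<Sum>i\<in>I. f i x) x = (\<Sum>i\<in>I. pd v (f i) x)"
  by (rule pd_eqI) (intro has_derivative_sum has_derivative_pd assms)

lemma pd_scaleR:
  assumes "f differentiable (at x)"
  shows "pd v (\<lambda>x. c *\<^sub>R f x) x = c *\<^sub>R pd v f x"
  by (rule pd_eqI) (intro has_derivative_scaleR_right has_derivative_pd assms)

lemma linear_pd:
  assumes "f differentiable (at x)"
  shows "linear (\<lambda>v. pd v f x)"
  by (rule has_derivative_linear[OF has_derivative_pd[OF assms]])

lemma vector_derivative_compose_pd:
  assumes "f differentiable (at (\<gamma> t))" "(\<gamma> has_vector_derivative v) (at t)"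
  shows "vector_derivative (\<lambda>t. f (\<gamma> t)) (at t) = pd v f (\<gamma> t)"
proof (rule vector_derivative_at)
  show "((\<lambda>t. f (\<gamma> t)) has_vector_derivative pd v f (\<gamma> t)) (at t)"
    using has_derivative_compose[OF assms(2)[unfolded has_vector_derivative_def] has_derivative_pd[OF assms(1)]]
    by (simp add: has_vector_derivative_def linear_scale[OF linear_pd[OF assms(1)]])
qed

text \<open>Linearity and locality are demanded only for smooth functions and at points of
  \<open>S\<close>: the operators act on total functions, whose values off \<open>S\<close> are
  arbitrary.\<close>

locale smooth_op =
  fixes S :: "'a::euclidean_space set" and T :: "('a \<Rightarrow> complex) \<Rightarrow> 'a \<Rightarrow> complex"
  assumes smooth: "smooth_fun_on S f \<Longrightarrow> smooth_fun_on S (T f)"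
    and cong_on: "smooth_fun_on S f \<Longrightarrow> (\<And>y. y \<in> S \<Longrightarrow> f y = g y) \<Longrightarrow> x \<in> S \<Longrightarrow> T f x = T g x"
    and add: "smooth_fun_on S f \<Longrightarrow> smooth_fun_on S g \<Longrightarrow> x \<in> S \<Longrightarrow>
      T (\<lambda>y. f y + g y) x = T f x + T g x"
    and scaleR: "smooth_fun_on S f \<Longrightarrow> x \<in> S \<Longrightarrow> T (\<lambda>y. c *\<^sub>R f y) x = c *\<^sub>R T f x"

lemma smooth_op_cong:
  assumes S: "open S" and T: "smooth_op S T"
    and eq: "\<And>f x. smooth_fun_on S f \<Longrightarrow> x \<in> S \<Longrightarrow> U f x = T f x"
  shows "smooth_op S U"
proof
  interpret T: smooth_op S T by fact
  fix f assume f: "smooth_fun_on S f"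
  show "smooth_fun_on S (U f)"
    by (rule smooth_cong[OF S _ T.smooth[OF f]]) (simp add: eq f)
  show "U f x = U g x" if fg: "\<And>y. y \<in> S \<Longrightarrow> f y = g y" and x: "x \<in> S" for g x
  proof -
    have g: "smooth_fun_on S g" by (rule smooth_cong[OF S fg f])
    show ?thesis
      unfolding eq[OF f x] eq[OF g x] by (rule T.cong_on[OF f fg x])
  qed
  show "U (\<lambda>y. f y + g y) x = U f x + U g x" if "smooth_fun_on S g" "x \<in> S" for g x
    using f that by (simp add: eq smooth_add S T.add)
  show "U (\<lambda>y. c *\<^sub>R f y) x = c *\<^sub>R U f x" if "x \<in> S" for c x
    using f that by (simp add: eq smooth_scaleR S T.scaleR)
qed

lemma smooth_op_pd:
  assumes S: "open S"
  shows "smooth_op S (pd v)"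
proof
  fix f assume f: "smooth_fun_on S f"
  show "smooth_fun_on S (pd v f)" using f by (rule smooth_pd)
  show "pd v f x = pd v g x" if "\<And>y. y \<in> S \<Longrightarrow> f y = g y" "x \<in> S" for g x
    by (rule pd_cong(1)[OF S that smooth_differentiable[OF f that(2)], symmetric])
qed (simp_all add: pd_add pd_scaleR smooth_differentiable)

lemma smooth_op_mult: "open S \<Longrightarrow> smooth_fun_on S h \<Longrightarrow> smooth_op S (\<lambda>f x. h x * f x)"
  by unfold_locales (simp_all add: smooth_mult distrib_left)

lemma smooth_op_zero: "smooth_op S (\<lambda>f x. 0)"
  by unfold_locales (simp_all add: smooth_const)

lemma smooth_op_comp:
  assumes S: "open S" and "smooth_op S T" "smooth_op S U"
  shows "smooth_op S (\<lambda>f. T (U f))"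
proof -
  interpret T: smooth_op S T by fact
  interpret U: smooth_op S U by fact
  show ?thesis
  proof
    fix f assume f: "smooth_fun_on S f"
    show "smooth_fun_on S (T (U f))"
      by (intro T.smooth U.smooth f)
    show "T (U f) x = T (U g) x" if "\<And>y. y \<in> S \<Longrightarrow> f y = g y" "x \<in> S" for g x
      by (rule T.cong_on[OF U.smooth[OF f] U.cong_on[OF f that(1)] that(2)])
    show "T (U (\<lambda>y. f y + g y)) x = T (U f) x + T (U g) x"
      if g: "smooth_fun_on S g" and x: "x \<in> S" for g x
      unfolding T.add[OF U.smooth[OF f] U.smooth[OF g] x, symmetric]
      by (rule T.cong_on[OF U.smooth[OF smooth_add[OF S f g]] U.add[OF f g] x])
    show "T (U (\<lambda>y. c *\<^sub>R f y)) x = c *\<^sub>R T (U f) x" if x: "x \<in> S" for c x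
      unfolding T.scaleR[OF U.smooth[OF f] x, symmetric]
      by (rule T.cong_on[OF U.smooth[OF smooth_scaleR[OF S f]] U.scaleR[OF f] x])
  qed
qed

lemma smooth_op_add:
  assumes S: "open S" and "smooth_op S T" "smooth_op S U"
  shows "smooth_op S (\<lambda>f x. T f x + U f x)"
proof -
  interpret T: smooth_op S T by fact
  interpret U: smooth_op S U by fact
  show ?thesis
  proof
    fix f assume f: "smooth_fun_on S f"
    show "T f x + U f x = T g x + U g x" if "\<And>y. y \<in> S \<Longrightarrow> f y = g y" "x \<in> S" for g x
      using T.cong_on[OF f that] U.cong_on[OF f that] by simp
  qed (simp_all add: smooth_add S T.smooth U.smooth T.add U.add T.scaleR U.scaleR scaleR_add_right)
qed

lemma smooth_op_sum:
  assumes "open S" "\<And>i. i \<in> I \<Longrightarrow> smooth_op S (T i)"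
  shows "smooth_op S (\<lambda>f x. \<Sum>i\<in>I. T i f x)"
  using assms(2)
  by (induction I rule: infinite_finite_induct) (simp_all add: smooth_op_zero smooth_op_add assms(1))

section \<open>Commuting operators\<close>

definition commute_on ::
  "'a::euclidean_space set \<Rightarrow> (('a \<Rightarrow> complex) \<Rightarrow> 'a \<Rightarrow> complex) \<Rightarrow> (('a \<Rightarrow> complex) \<Rightarrow> 'a \<Rightarrow> complex) \<Rightarrow> bool"
  where "commute_on S T U \<longleftrightarrow> (\<forall>f x. smooth_fun_on S f \<longrightarrow> x \<in> S \<longrightarrow> T (U f) x = U (T f) x)"

lemma commute_onI:
  "(\<And>f x. smooth_fun_on S f \<Longrightarrow> x \<in> S \<Longrightarrow> T (U f) x = U (T f) x) \<Longrightarrow> commute_on S T U"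
  by (simp add: commute_on_def)

lemma commute_onD:
  "commute_on S T U \<Longrightarrow> smooth_fun_on S f \<Longrightarrow> x \<in> S \<Longrightarrow> T (U f) x = U (T f) x"
  by (simp add: commute_on_def)

lemma commute_on_sym: "commute_on S T U \<Longrightarrow> commute_on S U T"
  by (simp add: commute_on_def)

lemma commute_on_comp:
  assumes "smooth_op S T" "smooth_op S U" "smooth_op S V"
    and TU: "commute_on S T U" and TV: "commute_on S T V"
  shows "commute_on S T (\<lambda>f. U (V f))"
proof (rule commute_onI)
  interpret T: smooth_op S T by fact
  interpret U: smooth_op S U by fact
  interpret V: smooth_op S V by fact
  fix f x assume f: "smooth_fun_on S f" and x: "x \<in> S"
  have "T (U (V f)) x = U (T (V f)) x"
    by (rule commute_onD[OF TU V.smooth[OF f] x])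
  also have "\<dots> = U (V (T f)) x"
    by (rule U.cong_on[OF T.smooth[OF V.smooth[OF f]] commute_onD[OF TV f] x])
  finally show "T (U (V f)) x = U (V (T f)) x" .
qed

lemma commute_on_sum:
  assumes S: "open S" and "smooth_op S T" and U: "\<And>i. i \<in> I \<Longrightarrow> smooth_op S (U i)"
    and TU: "\<And>i. i \<in> I \<Longrightarrow> commute_on S T (U i)"
  shows "commute_on S T (\<lambda>f x. \<Sum>i\<in>I. U i f x)"
proof (rule commute_onI)
  interpret T: smooth_op S T by fact
  fix f x assume f: "smooth_fun_on S f" and x: "x \<in> S"
  \<comment> \<open>Serves the empty index set and the infinite one, where the sum is 0 by
    convention.\<close>
  have T0: "T (\<lambda>x. 0) x = 0"
    using T.scaleR[OF smooth_const x, of 0 0] by simp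
  show "T (\<lambda>x. \<Sum>i\<in>I. U i f x) x = (\<Sum>i\<in>I. U i (T f) x)"
    using U TU
  proof (induction I rule: infinite_finite_induct)
    case (insert i I)
    have "T (\<lambda>x. U i f x + (\<Sum>i\<in>I. U i f x)) x = T (U i f) x + T (\<lambda>x. \<Sum>i\<in>I. U i f x) x"
      by (rule T.add[OF _ _ x])
        (auto intro!: smooth_sum S smooth_op.smooth[OF insert.prems(1)] f)
    then show ?case
      using insert commute_onD[OF insert.prems(2) f x, of i] by simp
  qed (simp_all add: T0)
qed

section \<open>The operators on a Damek--Ricci space\<close>

lemma open_DR_space: "open (DR_space :: ('n::euclidean_space \<times> real) set)"
  unfolding DR_space_def by (intro open_Times) simp_all

lemma DR_space_snd_pos: "p \<in> DR_space \<Longrightarrow> 0 < snd p"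
  by (auto simp: DR_space_def)

section \<open>The basic fields as directional derivatives\<close>

lemma d_rho_eq_pd:
  assumes "smooth_fun_on DR_space f" "p \<in> DR_space"
  shows "d_rho f p = pd (0, 1) f p"
proof (cases p)
  case (Pair U r)
  have "((\<lambda>s. (U, s)) has_vector_derivative (0, 1)) (at r)"
    by (auto intro!: has_vector_derivative_Pair derivative_eq_intros)
  from vector_derivative_compose_pd[OF _ this, of f] show ?thesis
    using smooth_differentiable[OF assms] by (simp add: Pair d_rho_def)
qed

lemma d_dir_eq_pd:
  assumes "smooth_fun_on DR_space f" "p \<in> DR_space"
  shows "d_dir V f p = pd (V, 0) f p"
proof (cases p)
  case (Pair U r)
  have "((\<lambda>t. (U + t *\<^sub>R V, r)) has_vector_derivative (V, 0)) (at 0)"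
    by (auto intro!: has_vector_derivative_Pair derivative_eq_intros)
  from vector_derivative_compose_pd[OF _ this, of f] show ?thesis
    using smooth_differentiable[OF assms] by (simp add: Pair d_dir_def)
qed

text \<open>By bilinearity the curve through \<open>U\<close> is a straight line with velocity
  \<open>V + [U, V] / 2\<close>.\<close>

lemma left_inv_field_eq_pd:
  assumes "bilinear br" "smooth_fun_on DR_space f" "p \<in> DR_space"
  shows "left_inv_field br V f p = pd (V + (1/2) *\<^sub>R br (fst p) V, 0) f p"
proof (cases p)
  case (Pair U r)
  let ?W = "V + (1/2) *\<^sub>R br U V"
  have "N_mult br U (t *\<^sub>R V) = U + t *\<^sub>R ?W" for t
    by (simp add: N_mult_def bilinear_rmul[OF assms(1)] algebra_simps)
  moreover have "((\<lambda>t. (U + t *\<^sub>R ?W, r)) has_vector_derivative (?W, 0)) (at 0)"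
    by (auto intro!: has_vector_derivative_Pair derivative_eq_intros)
  from vector_derivative_compose_pd[OF _ this, of f]
  have "vector_derivative (\<lambda>t. f (U + t *\<^sub>R ?W, r)) (at 0) = pd (?W, 0) f (U, r)"
    using smooth_differentiable[OF assms(2,3)] by (simp add: Pair)
  ultimately show ?thesis by (simp add: Pair left_inv_field_def)
qed

text \<open>Coordinate of the velocity \<open>V + [U, V] / 2\<close> along \<open>b\<close>. Since
  the velocity varies with the point, the field is expanded in constant directions, whose
  derivatives commute.\<close>

definition field_coeff :: "('n::euclidean_space \<Rightarrow> 'n \<Rightarrow> 'n) \<Rightarrow> 'n \<Rightarrow> 'n \<Rightarrow> 'n fn" where
  "field_coeff br V b p = complex_of_real ((V + (1/2) *\<^sub>R br (fst p) V) \<bullet> b)"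

lemma has_derivative_field_coeff:
  assumes "bilinear br"
  shows "(field_coeff br V b has_derivative (\<lambda>w. complex_of_real ((1/2) * (br (fst w) V \<bullet> b)))) (at p)"
proof -
  have "linear (\<lambda>U. br U V)" using assms by (simp add: bilinear_def)
  then have "bounded_linear (\<lambda>U. br U V)" by (simp add: linear_conv_bounded_linear)
  then have "((\<lambda>p. br (fst p) V) has_derivative (\<lambda>w. br (fst w) V)) (at p)"
    by (intro bounded_linear.has_derivative[of "\<lambda>U. br U V"] has_derivative_fst has_derivative_ident)
  then show ?thesis
    unfolding field_coeff_def by (auto intro!: derivative_eq_intros)
qed

lemma smooth_field_coeff:
  assumes "bilinear br" "open S"
  shows "smooth_fun_on S (field_coeff br V b)"
  by (rule smooth_fun_onI_derivative[OF assms(2) has_derivative_field_coeff[OF assms(1)] smooth_const])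

lemma left_inv_field_eq_sum:
  assumes "bilinear br" "smooth_fun_on DR_space f" "p \<in> DR_space"
  shows "left_inv_field br V f p = (\<Sum>b\<in>Basis. field_coeff br V b p * pd (b, 0) f p)"
proof -
  let ?W = "V + (1/2) *\<^sub>R br (fst p) V"
  interpret pd: linear "\<lambda>v. pd v f p"
    by (rule linear_pd[OF smooth_differentiable[OF assms(2,3)]])
  have "(?W, 0::real) = (\<Sum>b\<in>Basis. (?W \<bullet> b) *\<^sub>R (b, 0))"
    by (simp add: prod_eq_iff fst_sum snd_sum euclidean_representation)
  then have "pd (?W, 0) f p = (\<Sum>b\<in>Basis. (?W \<bullet> b) *\<^sub>R pd (b, 0) f p)"
    by (simp only: pd.sum pd.scale)
  then show ?thesis
    by (simp add: left_inv_field_eq_pd[OF assms] field_coeff_def scaleR_conv_of_real)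
qed

lemma smooth_powr:
  "smooth_fun_on DR_space (\<lambda>p. complex_of_real (snd p powr s))"
proof (rule smooth_fun_onI[where R = "\<lambda>f. \<exists>c s. f = (\<lambda>p. complex_of_real (c * snd p powr s))"])
  \<comment> \<open>The multiples of powers of rho form a class closed under \<open>pd\<close> on
    \<open>DR_space\<close>, as \<open>smooth_fun_onI\<close> requires.\<close>
  have D: "((\<lambda>p. complex_of_real (c * snd p powr s)) has_derivative
      (\<lambda>w. complex_of_real ((snd w * c * s) * snd p powr (s - 1)))) (at p)"
    if "p \<in> DR_space" for c s and p :: "'a \<times> real"
    using DR_space_snd_pos[OF that]
    by (auto intro!: derivative_eq_intros simp: powr_diff)
  show "open (DR_space :: ('a \<times> real) set)" by (rule open_DR_space)
  show "\<exists>c s'. (\<lambda>p::'a \<times> real. complex_of_real (snd p powr s)) = (\<lambda>p. complex_of_real (c * snd p powr s'))"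
    by (rule exI[of _ 1]) auto
  show "f differentiable at x"
    if "\<exists>c s. f = (\<lambda>p. complex_of_real (c * snd p powr s))" "x \<in> DR_space" for f and x :: "'a \<times> real"
    using that differentiableI[OF D] by blast
  show "\<exists>g. (\<exists>c s. g = (\<lambda>p. complex_of_real (c * snd p powr s))) \<and> (\<forall>x\<in>DR_space. pd v f x = g x)"
    if "\<exists>c s. f = (\<lambda>p. complex_of_real (c * snd p powr s))" for f and v :: "'a \<times> real"
    using that pd_eqI[OF D] by blast
qed

lemma pd_powr:
  assumes "p \<in> DR_space"
  shows "pd w (\<lambda>p. complex_of_real (snd p powr s)) p = complex_of_real (snd w * s * snd p powr (s - 1))"
proof (rule pd_eqI)
  show "((\<lambda>p. complex_of_real (snd p powr s)) has_derivative
      (\<lambda>w. complex_of_real (snd w * s * snd p powr (s - 1)))) (at p)"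
    using DR_space_snd_pos[OF assms]
    by (auto intro!: derivative_eq_intros simp: powr_diff)
qed

lemma rho_pow_eq: "rho_pow s f p = complex_of_real (snd p powr s) * f p"
  by (cases p) (simp add: rho_pow_def scaleR_conv_of_real)

text \<open>The Leibniz rule; \<open>snd w\<close> is the rho-component of the direction, so the
  second term vanishes for directions along N.\<close>

lemma pd_rho_pow:
  assumes "smooth_fun_on DR_space f" "p \<in> DR_space"
  shows "pd w (rho_pow s f) p = rho_pow s (pd w f) p + (snd w * s) *\<^sub>R rho_pow (s - 1) f p"
  using pd_mult[OF smooth_differentiable[OF smooth_powr assms(2)] smooth_differentiable[OF assms]]
  by (simp add: rho_pow_eq[abs_def] pd_powr assms(2) scaleR_conv_of_real)

lemma smooth_op_d_rho: "smooth_op DR_space d_rho"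
  by (rule smooth_op_cong[OF open_DR_space smooth_op_pd[OF open_DR_space] d_rho_eq_pd])

lemma smooth_op_d_dir: "smooth_op DR_space (d_dir V)"
  by (rule smooth_op_cong[OF open_DR_space smooth_op_pd[OF open_DR_space] d_dir_eq_pd])

lemma smooth_op_left_inv_field:
  assumes "bilinear br"
  shows "smooth_op DR_space (left_inv_field br V)"
proof (rule smooth_op_cong[OF open_DR_space _ left_inv_field_eq_sum[OF assms]])
  show "smooth_op DR_space (\<lambda>f p. \<Sum>b\<in>Basis. field_coeff br V b p * pd (b, 0) f p)"
    by (intro smooth_op_sum open_DR_space smooth_op_pd
        smooth_op_comp[OF open_DR_space smooth_op_mult[OF open_DR_space smooth_field_coeff]] assms)
qed

lemma smooth_op_rho_pow: "smooth_op DR_space (rho_pow s)"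
  unfolding rho_pow_eq[abs_def] by (rule smooth_op_mult[OF open_DR_space smooth_powr])

lemma smooth_op_laplacian_Z: "smooth_op DR_space (laplacian_Z F)"
  unfolding laplacian_Z_def[abs_def]
  by (rule smooth_op_sum[OF open_DR_space smooth_op_comp[OF open_DR_space smooth_op_d_dir smooth_op_d_dir]])

lemma smooth_op_sub_laplacian:
  assumes "bilinear br"
  shows "smooth_op DR_space (sub_laplacian br E)"
  unfolding sub_laplacian_def[abs_def]
  by (rule smooth_op_sum[OF open_DR_space smooth_op_comp[OF open_DR_space]])
    (rule smooth_op_left_inv_field[OF assms])+

section \<open>Commutation relations\<close>

lemma commute_on_laplacian_Z:
  assumes T: "smooth_op DR_space T" and c: "\<And>e. e \<in> F \<Longrightarrow> commute_on DR_space T (d_dir e)"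
  shows "commute_on DR_space T (laplacian_Z F)"
  unfolding laplacian_Z_def[abs_def]
  by (rule commute_on_sum[OF open_DR_space T smooth_op_comp[OF open_DR_space smooth_op_d_dir smooth_op_d_dir]])
    (rule commute_on_comp[OF T smooth_op_d_dir smooth_op_d_dir c c])

lemma commute_on_sub_laplacian:
  assumes br: "bilinear br" and T: "smooth_op DR_space T"
    and c: "\<And>e. e \<in> E \<Longrightarrow> commute_on DR_space T (left_inv_field br e)"
  shows "commute_on DR_space T (sub_laplacian br E)"
proof -
  note X = smooth_op_left_inv_field[OF br]
  show ?thesis
    unfolding sub_laplacian_def[abs_def]
    by (rule commute_on_sum[OF open_DR_space T smooth_op_comp[OF open_DR_space X X]])
      (rule commute_on_comp[OF T X X c c])
qed

lemma commute_on_rho_pow_d_dir: "commute_on DR_space (rho_pow s) (d_dir V)"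
proof (rule commute_onI)
  fix f :: "'a fn" and p :: "'a \<times> real"
  assume f: "smooth_fun_on DR_space f" and p: "p \<in> DR_space"
  show "rho_pow s (d_dir V f) p = d_dir V (rho_pow s f) p"
    using pd_rho_pow[OF f p] d_dir_eq_pd[OF smooth_op.smooth[OF smooth_op_rho_pow f] p]
    by (simp add: rho_pow_eq d_dir_eq_pd[OF f p])
qed

lemma commute_on_rho_pow_left_inv_field:
  assumes "bilinear br"
  shows "commute_on DR_space (rho_pow s) (left_inv_field br V)"
proof (rule commute_onI)
  fix f :: "'a fn" and p :: "'a \<times> real"
  assume f: "smooth_fun_on DR_space f" and p: "p \<in> DR_space"
  show "rho_pow s (left_inv_field br V f) p = left_inv_field br V (rho_pow s f) p"
    using pd_rho_pow[OF f p] left_inv_field_eq_pd[OF assms smooth_op.smooth[OF smooth_op_rho_pow f] p]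
    by (simp add: rho_pow_eq left_inv_field_eq_pd[OF assms f p])
qed

lemma pd_local:
  assumes "smooth_fun_on DR_space g" "\<And>q. q \<in> DR_space \<Longrightarrow> f q = g q" "p \<in> DR_space"
  shows "pd v f p = pd v g p"
  by (rule pd_cong(1)[OF open_DR_space assms(2)[symmetric] assms(3) smooth_differentiable[OF assms(1,3)]])

text \<open>The condition \<open>w\<close> makes the coefficients of the field constant along the
  direction, after which \<open>pd_commute\<close> applies. It covers the rho-direction, where
  \<open>fst w = 0\<close>, and the central directions.\<close>

lemma pd_left_inv_field:
  assumes br: "bilinear br" and f: "smooth_fun_on DR_space f" and p: "p \<in> DR_space"
    and w: "br (fst w) V = 0"
  shows "pd w (left_inv_field br V f) p = left_inv_field br V (pd w f) p"
proof -
  let ?c = "field_coeff br V"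
  have smooth_c: "smooth_fun_on DR_space (?c b)" for b
    by (rule smooth_field_coeff[OF br open_DR_space])
  have c0: "pd w (?c b) p = 0" for b
    using pd_eqI[OF has_derivative_field_coeff[OF br, of V b p], of w] by (simp add: w)
  have "pd w (left_inv_field br V f) p = pd w (\<lambda>p. \<Sum>b\<in>Basis. ?c b p * pd (b, 0) f p) p"
    by (rule pd_local[OF _ left_inv_field_eq_sum[OF br f] p])
      (intro smooth_sum smooth_mult smooth_c smooth_pd f open_DR_space)
  also have "\<dots> = (\<Sum>b\<in>Basis. pd w (\<lambda>p. ?c b p * pd (b, 0) f p) p)"
    by (rule pd_sum) (intro smooth_differentiable[OF _ p] smooth_mult smooth_c smooth_pd f open_DR_space)
  also have "\<dots> = (\<Sum>b\<in>Basis. ?c b p * pd (b, 0) (pd w f) p)"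
  proof (rule sum.cong[OF refl])
    fix b :: 'a
    show "pd w (\<lambda>p. ?c b p * pd (b, 0) f p) p = ?c b p * pd (b, 0) (pd w f) p"
      using pd_mult[OF smooth_differentiable[OF smooth_c p] smooth_differentiable[OF smooth_pd[OF f] p]]
      by (simp add: c0 pd_commute[OF open_DR_space f p])
  qed
  also have "\<dots> = left_inv_field br V (pd w f) p"
    by (rule left_inv_field_eq_sum[OF br smooth_pd[OF f] p, symmetric])
  finally show ?thesis .
qed

lemma commute_on_d_rho_left_inv_field:
  assumes br: "bilinear br"
  shows "commute_on DR_space d_rho (left_inv_field br V)"
proof (rule commute_onI)
  interpret X: smooth_op DR_space "left_inv_field br V" by (rule smooth_op_left_inv_field[OF br])
  fix f :: "'a fn" and p :: "'a \<times> real"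
  assume f: "smooth_fun_on DR_space f" and p: "p \<in> DR_space"
  have "d_rho (left_inv_field br V f) p = left_inv_field br V (pd (0, 1) f) p"
    unfolding d_rho_eq_pd[OF X.smooth[OF f] p]
    by (rule pd_left_inv_field[OF br f p]) (simp add: bilinear_lzero[OF br])
  also have "\<dots> = left_inv_field br V (d_rho f) p"
    by (rule X.cong_on[OF smooth_pd[OF f] d_rho_eq_pd[OF f, symmetric] p])
  finally show "d_rho (left_inv_field br V f) p = left_inv_field br V (d_rho f) p" .
qed

lemma commute_on_d_dir_left_inv_field:
  assumes br: "bilinear br" and Z: "br Z V = 0"
  shows "commute_on DR_space (d_dir Z) (left_inv_field br V)"
proof (rule commute_onI)
  interpret X: smooth_op DR_space "left_inv_field br V" by (rule smooth_op_left_inv_field[OF br])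
  fix f :: "'a fn" and p :: "'a \<times> real"
  assume f: "smooth_fun_on DR_space f" and p: "p \<in> DR_space"
  have "d_dir Z (left_inv_field br V f) p = left_inv_field br V (pd (Z, 0) f) p"
    unfolding d_dir_eq_pd[OF X.smooth[OF f] p]
    by (rule pd_left_inv_field[OF br f p]) (simp add: Z)
  also have "\<dots> = left_inv_field br V (d_dir Z f) p"
    by (rule X.cong_on[OF smooth_pd[OF f] d_dir_eq_pd[OF f, symmetric] p])
  finally show "d_dir Z (left_inv_field br V f) p = left_inv_field br V (d_dir Z f) p" .
qed

lemma commute_on_d_rho_d_dir: "commute_on DR_space d_rho (d_dir V)"
proof (rule commute_onI)
  fix f :: "'a fn" and p :: "'a \<times> real"
  assume f: "smooth_fun_on DR_space f" and p: "p \<in> DR_space"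
  have "d_rho (d_dir V f) p = pd (0, 1) (pd (V, 0) f) p"
    unfolding d_rho_eq_pd[OF smooth_op.smooth[OF smooth_op_d_dir f] p]
    by (rule pd_local[OF smooth_pd[OF f] d_dir_eq_pd[OF f] p])
  also have "\<dots> = pd (V, 0) (pd (0, 1) f) p"
    by (rule pd_commute[OF open_DR_space f p])
  also have "\<dots> = d_dir V (d_rho f) p"
    unfolding d_dir_eq_pd[OF smooth_op.smooth[OF smooth_op_d_rho f] p]
    by (rule pd_local[OF smooth_pd[OF f] d_rho_eq_pd[OF f] p, symmetric])
  finally show "d_rho (d_dir V f) p = d_dir V (d_rho f) p" .
qed

section \<open>The vector space of smooth functions\<close>

text \<open>Requiring the value \<open>0\<close> off \<open>DR_space\<close> makes equality of elements the same as equality on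
  \<open>DR_space\<close>.\<close>

typedef (overloaded) ('n::euclidean_space) smooth_DR =
  "{f :: 'n fn. smooth_fun_on DR_space f \<and> (\<forall>p. p \<notin> DR_space \<longrightarrow> f p = 0)}"
  by (rule exI[of _ "\<lambda>_. 0"]) (simp add: smooth_const)

setup_lifting type_definition_smooth_DR

instantiation smooth_DR :: (euclidean_space) real_vector
begin

lift_definition zero_smooth_DR :: "'a smooth_DR" is "\<lambda>_. 0"
  by (simp add: smooth_const)

lift_definition plus_smooth_DR :: "'a smooth_DR \<Rightarrow> 'a smooth_DR \<Rightarrow> 'a smooth_DR"
  is "\<lambda>f g p. f p + g p"
  by (simp add: smooth_add open_DR_space)

lift_definition scaleR_smooth_DR :: "real \<Rightarrow> 'a smooth_DR \<Rightarrow> 'a smooth_DR"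
  is "\<lambda>c f p. c *\<^sub>R f p"
  by (simp add: smooth_scaleR open_DR_space)

definition "uminus_smooth_DR (x :: 'a smooth_DR) = (-1) *\<^sub>R x"

definition "minus_smooth_DR (x :: 'a smooth_DR) y = x + (-1) *\<^sub>R y"

instance
  by standard
    (simp_all add: uminus_smooth_DR_def minus_smooth_DR_def, (transfer; simp add: algebra_simps fun_eq_iff)+)

end

definition restrict_DR :: "'n fn \<Rightarrow> 'n::euclidean_space smooth_DR" where
  "restrict_DR f = Abs_smooth_DR (\<lambda>p. if p \<in> DR_space then f p else 0)"

lemma smooth_Rep: "smooth_fun_on DR_space (Rep_smooth_DR x)"
  using Rep_smooth_DR by blast

lemma Rep_restrict_DR:
  assumes "smooth_fun_on DR_space f"
  shows "Rep_smooth_DR (restrict_DR f) p = (if p \<in> DR_space then f p else 0)"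
proof -
  have "smooth_fun_on DR_space (\<lambda>p. if p \<in> DR_space then f p else 0)"
    by (rule smooth_cong[OF open_DR_space _ assms]) simp
  then show ?thesis
    unfolding restrict_DR_def by (subst Abs_smooth_DR_inverse) auto
qed

lemma restrict_DR_cong:
  "(\<And>p. p \<in> DR_space \<Longrightarrow> f p = g p) \<Longrightarrow> restrict_DR f = restrict_DR g"
  unfolding restrict_DR_def by (intro arg_cong[where f = Abs_smooth_DR]) auto

lemma restrict_DR_Rep: "restrict_DR (Rep_smooth_DR x) = x"
proof -
  have "(\<lambda>p. if p \<in> DR_space then Rep_smooth_DR x p else 0) = Rep_smooth_DR x"
    using Rep_smooth_DR[of x] by auto
  then show ?thesis by (simp add: restrict_DR_def Rep_smooth_DR_inverse)
qed

lemma restrict_DR_add: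
  assumes "smooth_fun_on DR_space f" "smooth_fun_on DR_space g"
  shows "restrict_DR (\<lambda>p. f p + g p) = restrict_DR f + restrict_DR g"
  by (rule Rep_smooth_DR_inject[THEN iffD1])
    (simp add: fun_eq_iff plus_smooth_DR.rep_eq Rep_restrict_DR smooth_add open_DR_space assms)

lemma restrict_DR_scaleR:
  assumes "smooth_fun_on DR_space f"
  shows "restrict_DR (\<lambda>p. c *\<^sub>R f p) = c *\<^sub>R restrict_DR f"
  by (rule Rep_smooth_DR_inject[THEN iffD1])
    (simp add: fun_eq_iff scaleR_smooth_DR.rep_eq Rep_restrict_DR smooth_scaleR open_DR_space assms)

text \<open>Preservation of smoothness is included so that representations can be composed; an
  identity between abstract operators then carries over to the concrete ones.\<close>

definition represents ::
  "('n::euclidean_space fn \<Rightarrow> 'n fn) \<Rightarrow> ('n smooth_DR \<Rightarrow> 'n smooth_DR) \<Rightarrow> bool" where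
  "represents T H \<longleftrightarrow> (\<forall>f. smooth_fun_on DR_space f \<longrightarrow>
     smooth_fun_on DR_space (T f) \<and> H (restrict_DR f) = restrict_DR (T f))"

lemma representsD:
  assumes "represents T H" "smooth_fun_on DR_space f"
  shows "smooth_fun_on DR_space (T f)" "H (restrict_DR f) = restrict_DR (T f)"
  using assms by (simp_all add: represents_def)

text \<open>Every element is the restriction of its own representing function, so a pointwise
  identity on smooth functions suffices.\<close>

lemma represents_eqI:
  assumes "represents T G" "represents U H"
    and "\<And>f p. smooth_fun_on DR_space f \<Longrightarrow> p \<in> DR_space \<Longrightarrow> T f p = U f p"
  shows "G x = H x"
proof -
  note x = smooth_Rep[of x]
  have "G x = restrict_DR (T (Rep_smooth_DR x))"
    using representsD(2)[OF assms(1) x] by (simp add: restrict_DR_Rep)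
  also have "\<dots> = restrict_DR (U (Rep_smooth_DR x))"
    by (rule restrict_DR_cong) (rule assms(3)[OF x])
  also have "\<dots> = H x"
    using representsD(2)[OF assms(2) x] by (simp add: restrict_DR_Rep)
  finally show ?thesis .
qed

lemma represents_id: "represents (\<lambda>f. f) (\<lambda>x. x)"
  by (simp add: represents_def)

lemma represents_comp:
  "represents T G \<Longrightarrow> represents U H \<Longrightarrow> represents (\<lambda>f. T (U f)) (\<lambda>x. G (H x))"
  by (simp add: represents_def)

lemma represents_add:
  "represents T G \<Longrightarrow> represents U H \<Longrightarrow> represents (\<lambda>f p. T f p + U f p) (\<lambda>x. G x + H x)"
  by (simp add: represents_def smooth_add open_DR_space restrict_DR_add)

lemma represents_scaleR:
  "represents T H \<Longrightarrow> represents (\<lambda>f p. c *\<^sub>R T f p) (\<lambda>x. c *\<^sub>R H x)"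
  by (simp add: represents_def smooth_scaleR open_DR_space restrict_DR_scaleR)

lemma represents_diff:
  assumes "represents T G" "represents U H"
  shows "represents (\<lambda>f p. T f p - U f p) (\<lambda>x. G x - H x)"
  using represents_add[OF assms(1) represents_scaleR[OF assms(2), of "-1"]] by simp

lemma represents_cong:
  assumes "represents T H"
    and "\<And>f p. smooth_fun_on DR_space f \<Longrightarrow> p \<in> DR_space \<Longrightarrow> U f p = T f p"
  shows "represents U H"
  unfolding represents_def
proof (intro allI impI conjI)
  fix f :: "'a fn" assume f: "smooth_fun_on DR_space f"
  note T = representsD[OF assms(1) f]
  show "smooth_fun_on DR_space (U f)"
    by (rule smooth_cong[OF open_DR_space _ T(1)]) (simp add: assms(2) f)
  show "H (restrict_DR f) = restrict_DR (U f)"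
    unfolding T(2) by (rule restrict_DR_cong) (simp add: assms(2) f)
qed

lemma represents_op_prod:
  assumes "\<And>j. represents (T j) (H j)"
  shows "represents (op_prod T n) (comp_prod H n)"
proof (induction n)
  case 0
  show ?case by (simp add: id_def represents_id)
next
  case (Suc n)
  show ?case using represents_comp[OF Suc assms] by (simp add: comp_def)
qed

definition induced :: "('n::euclidean_space fn \<Rightarrow> 'n fn) \<Rightarrow> 'n smooth_DR \<Rightarrow> 'n smooth_DR" where
  "induced T x = restrict_DR (T (Rep_smooth_DR x))"

text \<open>Truncating \<open>f\<close> changes it only off \<open>DR_space\<close>, and by locality
  the images under \<open>T\<close> still agree on \<open>DR_space\<close>.\<close>

lemma represents_induced:
  assumes "smooth_op DR_space T"
  shows "represents T (induced T)"
proof -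
  interpret T: smooth_op DR_space T by fact
  show ?thesis
    unfolding represents_def induced_def
    by (auto intro!: T.smooth restrict_DR_cong T.cong_on simp: Rep_restrict_DR smooth_Rep)
qed

lemma linear_induced:
  assumes "smooth_op DR_space T"
  shows "linear (induced T)"
proof -
  interpret T: smooth_op DR_space T by fact
  show ?thesis
  proof (rule linearI)
    show "induced T (x + y) = induced T x + induced T y" for x y
      unfolding induced_def plus_smooth_DR.rep_eq
      by (subst restrict_DR_add[symmetric]) (auto intro!: T.smooth smooth_Rep restrict_DR_cong T.add)
    show "induced T (c *\<^sub>R x) = c *\<^sub>R induced T x" for c x
      unfolding induced_def scaleR_smooth_DR.rep_eq
      by (subst restrict_DR_scaleR[symmetric]) (auto intro!: T.smooth smooth_Rep restrict_DR_cong T.scaleR)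
  qed
qed

lemma induced_commute:
  assumes "smooth_op DR_space T" "smooth_op DR_space U" "commute_on DR_space T U"
  shows "induced T (induced U x) = induced U (induced T x)"
  by (rule represents_eqI[OF represents_comp represents_comp, OF represents_induced represents_induced
        represents_induced represents_induced commute_onD, OF assms(1,2,2,1,3)])

lemma radial_operators_induced:
  assumes br: "bilinear br" and central: "\<And>Z V. Z \<in> F \<Longrightarrow> br Z V = 0"
  shows "radial_operators (\<lambda>t. induced (rho_pow t)) (induced d_rho)
    (induced (laplacian_Z F)) (induced (sub_laplacian br E))"
proof -
  note P = smooth_op_rho_pow and d = smooth_op_d_rho and D = smooth_op_laplacian_Z
    and L = smooth_op_sub_laplacian[OF br] and X = smooth_op_left_inv_field[OF br]
  note P' = represents_induced[OF P] and d' = represents_induced[OF d]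
  show ?thesis
  proof (rule radial_operators.intro)
    fix t u :: real and x :: "'a smooth_DR"
    show "linear (induced (rho_pow t) :: 'a smooth_DR \<Rightarrow> _)" "linear (induced d_rho :: 'a smooth_DR \<Rightarrow> _)"
      "linear (induced (laplacian_Z F))"
      "linear (induced (sub_laplacian br E))"
      by (rule linear_induced P d D L)+
    show "induced (rho_pow t) (induced (rho_pow u) x) = induced (rho_pow (t + u)) x"
      by (rule represents_eqI[OF represents_comp[OF P' P'] P'])
        (simp add: rho_pow_eq powr_add)
    \<comment> \<open>Positivity of rho matters here, since \<open>0 powr 0 = 0\<close>.\<close>
    show "induced (rho_pow 0) x = x"
      by (rule represents_eqI[OF P' represents_id])
        (use DR_space_snd_pos in \<open>fastforce simp: rho_pow_eq\<close>)
    show "induced d_rho (induced (rho_pow t) x)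
        = induced (rho_pow t) (induced d_rho x) + t *\<^sub>R induced (rho_pow (t - 1)) x"
    proof (rule represents_eqI[OF represents_comp[OF d' P'] represents_add[OF represents_comp[OF P' d'] represents_scaleR[OF P']]])
      show "d_rho (rho_pow t f) p = rho_pow t (d_rho f) p + t *\<^sub>R rho_pow (t - 1) f p"
        if f: "smooth_fun_on DR_space f" and p: "p \<in> DR_space" for f :: "'a fn" and p :: "'a \<times> real"
        using pd_rho_pow[OF f p, of "(0, 1)" t] d_rho_eq_pd[OF smooth_op.smooth[OF P f] p]
        by (simp add: rho_pow_eq d_rho_eq_pd[OF f p])
    qed
    show "induced (laplacian_Z F) (induced (rho_pow t) x) = induced (rho_pow t) (induced (laplacian_Z F) x)"
      by (rule induced_commute[OF D P commute_on_sym[OF commute_on_laplacian_Z[OF P]]])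
        (rule commute_on_rho_pow_d_dir)
    show "induced (sub_laplacian br E) (induced (rho_pow t) x) = induced (rho_pow t) (induced (sub_laplacian br E) x)"
      by (rule induced_commute[OF L P commute_on_sym[OF commute_on_sub_laplacian[OF br P]]])
        (rule commute_on_rho_pow_left_inv_field[OF br])
    show "induced (laplacian_Z F) (induced d_rho x) = induced d_rho (induced (laplacian_Z F) x)"
      by (rule induced_commute[OF D d commute_on_sym[OF commute_on_laplacian_Z[OF d]]])
        (rule commute_on_d_rho_d_dir)
    show "induced (sub_laplacian br E) (induced d_rho x) = induced d_rho (induced (sub_laplacian br E) x)"
      by (rule induced_commute[OF L d commute_on_sym[OF commute_on_sub_laplacian[OF br d]]])
        (rule commute_on_d_rho_left_inv_field[OF br])
    \<comment> \<open>The directions in \<open>F\<close> are central, so their brackets with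
      \<open>V\<close> vanish.\<close>
    have "commute_on DR_space (laplacian_Z F) (left_inv_field br V)" for V
      by (rule commute_on_sym[OF commute_on_laplacian_Z[OF X]])
        (rule commute_on_sym[OF commute_on_d_dir_left_inv_field[OF br central]])
    then show "induced (laplacian_Z F) (induced (sub_laplacian br E) x)
        = induced (sub_laplacian br E) (induced (laplacian_Z F) x)"
      by (rule induced_commute[OF D L commute_on_sub_laplacian[OF br D]])
  qed
qed

section \<open>The identity for smooth functions on \<open>DR_space\<close>\<close>

theorem theorem1p1:
  fixes br :: "'n::euclidean_space \<Rightarrow> 'n \<Rightarrow> 'n"
    and E F :: "'n set"
    and a Q :: real
    and k :: nat
    and f :: "'n \<times> real \<Rightarrow> complex"
  assumes "heisenberg_type br"
    and "orthonormal_basis_of E (horizontal br)"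
    and "orthonormal_basis_of F (lie_centre br)"
    and "Q = homogeneous_dim br"
    and "k \<ge> 1"
    and "smooth_fun_on DR_space f"
  shows "\<forall>p\<in>DR_space.
     rho_pow ((real k + Q + a) / 2)
       (paired_prod br E F a k (rho_pow ((real k - Q - a) / 2) f)) p
   = op_prod (\<lambda>j g q. quarter_LB br E F g q
         + (Q\<^sup>2 / 4 - (a - real k + 2 * real j - 2)\<^sup>2 / 4) *\<^sub>R g q) k f p"
proof
  fix p :: "'n \<times> real" assume p: "p \<in> DR_space"
  have br: "bilinear br"
    using assms(1) by (simp add: heisenberg_type_def two_step_lie_bracket_def)
  have "F \<subseteq> lie_centre br"
    using assms(3) span_superset by (auto simp: orthonormal_basis_of_def)
  then have central: "br Z V = 0" if "Z \<in> F" for Z V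
    using that by (auto simp: lie_centre_def)
  interpret radial_operators "\<lambda>t. induced (rho_pow t)" "induced d_rho"
    "induced (laplacian_Z F)" "induced (sub_laplacian br E)"
    by (rule radial_operators_induced[OF br central])
  have P: "represents (rho_pow t) (induced (rho_pow t))" for t
    by (rule represents_induced[OF smooth_op_rho_pow])
  have d: "represents d_rho (induced d_rho)"
    by (rule represents_induced[OF smooth_op_d_rho])
  have D: "represents (laplacian_Z F) (induced (laplacian_Z F))"
    by (rule represents_induced[OF smooth_op_laplacian_Z])
  have L: "represents (sub_laplacian br E) (induced (sub_laplacian br E))"
    by (rule represents_induced[OF smooth_op_sub_laplacian[OF br]])
  \<comment> \<open>Multiplication by \<open>r\<close> is \<open>rho_pow 1\<close> only where
    \<open>r powr 1 = r\<close>, hence the appeal to positivity on \<open>DR_space\<close>.\<close>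
  have A: "represents (op_A br E F a) (A a)"
    unfolding A_def[abs_def]
    by (rule represents_cong[OF represents_add[OF represents_add[OF represents_add[OF
              represents_comp[OF P represents_comp[OF d d]] represents_scaleR[OF d]]
              represents_comp[OF P D]] L]])
      (auto simp: op_A_def rho_pow_def dest: DR_space_snd_pos)
  have sq: "represents (op_A_sq_plus br E F a c)
      (\<lambda>x. A a (A a x) + c\<^sup>2 *\<^sub>R induced (laplacian_Z F) x)" for c
    unfolding op_A_sq_plus_def[abs_def]
    by (rule represents_add[OF represents_comp[OF A A] represents_scaleR[OF D]])
  have prod: "represents (paired_prod br E F a k) (paired a k)"
  proof (cases "even k")
    case True
    then show ?thesis
      unfolding paired_prod_def paired_def by (simp only: if_True represents_op_prod[OF sq])
  next
    case False
    then show ?thesis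
      unfolding paired_prod_def paired_def comp_def
      by (simp only: if_False represents_comp[OF A represents_op_prod[OF sq]])
  qed
  have M: "represents (quarter_LB br E F) (M Q)"
    unfolding M_def[abs_def]
    by (rule represents_cong[OF represents_comp[OF P represents_diff[OF represents_add[OF
              represents_comp[OF P represents_add[OF represents_comp[OF d d] D]] L] represents_scaleR[OF d]]]])
      (auto simp: quarter_LB_def rho_pow_def assms(4) dest: DR_space_snd_pos)
  let ?T = "\<lambda>j g q. quarter_LB br E F g q + (Q\<^sup>2 / 4 - (a - real k + 2 * real j - 2)\<^sup>2 / 4) *\<^sub>R g q"
  have lhs: "represents
      (\<lambda>f. rho_pow ((real k + Q + a) / 2) (paired_prod br E F a k (rho_pow ((real k - Q - a) / 2) f)))
      (\<lambda>x. induced (rho_pow ((real k + Q + a) / 2)) (paired a k (induced (rho_pow ((real k - Q - a) / 2)) x)))"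
    by (rule represents_comp[OF P represents_comp[OF prod P]])
  have rhs: "represents (op_prod ?T k)
      (comp_prod (\<lambda>j x. M Q x + (Q\<^sup>2 / 4 - (a - real k + 2 * real j - 2)\<^sup>2 / 4) *\<^sub>R x) k)"
    by (rule represents_op_prod)
      (rule represents_add[OF M represents_scaleR[OF represents_id]])
  \<comment> \<open>By \<open>conj_paired\<close> the two abstract operators agree on
    \<open>restrict_DR f\<close>; the concrete sides therefore have equal restrictions, which are
    evaluated at \<open>p\<close>.\<close>
  note representsD[OF lhs assms(6)] representsD[OF rhs assms(6)]
  then show "rho_pow ((real k + Q + a) / 2) (paired_prod br E F a k (rho_pow ((real k - Q - a) / 2) f)) p
      = op_prod ?T k f p"
    using p Rep_restrict_DR conj_paired by (metis (no_types, lifting))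
qed

end
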